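(* Let $\theta=-1$ (fermions) and let $\beta>0$ be given. There exists a constant $R_0$ such that if $|||F_0|||$ and $\beta^{-2}(R_0+R_0^2)$ are sufficiently small with $F_0\ge 0$, then the quantum Boltzmann equation $$\partial_tF+v\cdot\nabla_xF=Q[F,F;F],\qquad F(0,x,v)=F_0(x,v),\qquad (t,x,v)\in\mathbb{R}_+\times\mathbb{R}^3\times\mathbb{R}^3,$$ has a unique mild solution $F\in S_{R_0}$ with $F\ge 0$.
   Context: Collision operator (dependence on $t,x$ suppressed): $$Q[F,F;F](v)=\int_{\mathbb{R}^3}\int_{\mathbb{S}^2}|\omega\cdot(v-u)|\Big[F(u')F(v')(1+\theta F(u)+\theta F(v))-F(u)F(v)(1+\theta F(u')+\theta F(v'))\Big]d\omega\,du,$$ where $u'=u+\omega(\omega\cdot(v-u))$, $v'=v-\omega(\omega\cdot(v-u))$. Function space: $$S=\Big\{F\in C^0(\mathbb{R}_+\times\mathbb{R}^3\times\mathbb{R}^3):\ |F(t,x,v)|\le c\,e^{-\beta(|x|^2+|v|^2)}\text{ for some }c>0\Big\},\qquad |||F|||=\sup_{t,x,v}\Big(e^{\beta(|x|^2+|v|^2)}|F(t,x,v)|\Big),$$ and $S_R=\{F\in S:\ |||F|||\le R\}$. For the time-independent initial datum $F_0(x,v)$ the same norm reads $|||F_0|||=\sup_{x,v}e^{\beta(|x|^2+|v|^2)}|F_0(x,v)|$. For a function $F(t,x,v)$ put $F^{\#}(t,x,v)=F(t,x+tv,v)$ and $Q^{\#}[F,F;F](t,x,v)=Q[F,F;F](t,x+tv,v)$;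 the equation is equivalently $\partial_tF^{\#}=Q^{\#}[F,F;F]$. A mild solution is a function $F\in S$ satisfying $$F^{\#}(t,x,v)=F_0(x,v)+\int_0^tQ^{\#}[F,F;F](\tau,x,v)\,d\tau .$$
   Formalization: Membership of the mild solution in S and S_{R_0} is required of F^#(t,x,v)=F(t,x+tv,v) instead of F: for Gaussian F_0>0 no F≥0 in S_{R_0} solves the equation, since F^# stays bounded below along characteristics while F in S forces it to tend to 0. *)

theory Defs
  imports "HOL-Analysis.Analysis"
begin

text \<open>
  Surface measure on the unit sphere: the measure of \<open>A\<close> is three times the Lebesgue measure of the
  cone \<open>{r \<omega> | 0 < r < 1, \<omega> \<in> A}\<close> (polar coordinates in dimension 3); \<open>sgn x\<close> is \<open>x / norm x\<close>.
\<close>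
definition sphere_measure :: "(real^3) measure" where
  "sphere_measure =
     scale_measure 3
       (distr (restrict_space lborel (ball 0 1 - {0})) (restrict_space borel (sphere 0 1)) sgn)"

definition post_u :: "real^3 \<Rightarrow> real^3 \<Rightarrow> real^3 \<Rightarrow> real^3" where
  "post_u \<omega> u v = u + (\<omega> \<bullet> (v - u)) *\<^sub>R \<omega>"

definition post_v :: "real^3 \<Rightarrow> real^3 \<Rightarrow> real^3 \<Rightarrow> real^3" where
  "post_v \<omega> u v = v - (\<omega> \<bullet> (v - u)) *\<^sub>R \<omega>"

type_synonym phase_fun = "real \<Rightarrow> real^3 \<Rightarrow> real^3 \<Rightarrow> real"

text \<open>\<open>Qcoll \<theta> F\<close> is \<open>Q[F,F;F]\<close>; the arguments of \<open>F\<close> are \<open>t\<close>, \<open>x\<close>, \<open>v\<close>, and only those with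
  \<open>t \<ge> 0\<close> are meaningful.\<close>
definition Qcoll :: "real \<Rightarrow> phase_fun \<Rightarrow> phase_fun" where
  "Qcoll \<theta> F t x v =
     (LINT u|lborel. LINT \<omega>|sphere_measure.
        \<bar>\<omega> \<bullet> (v - u)\<bar> *
        (let f = F t x; u' = post_u \<omega> u v; v' = post_v \<omega> u v in
           f u' * f v' * (1 + \<theta> * f u + \<theta> * f v)
         - f u * f v * (1 + \<theta> * f u' + \<theta> * f v')))"

definition sharp :: "phase_fun \<Rightarrow> phase_fun" where
  "sharp F t x v = F t (x + t *\<^sub>R v) v"

definition S_space :: "real \<Rightarrow> phase_fun set" where
  "S_space \<beta> = {F. continuous_on ({0..} \<times> UNIV \<times> UNIV) (\<lambda>(t, x, v). F t x v) \<and>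
     (\<exists>c>0. \<forall>t\<ge>0. \<forall>x v. \<bar>F t x v\<bar> \<le> c * exp (- \<beta> * ((norm x)\<^sup>2 + (norm v)\<^sup>2)))}"

text \<open>The suprema below are used only for members of \<open>S_space\<close> and \<open>datum_space\<close>, where they are
  finite.\<close>
definition S_norm :: "real \<Rightarrow> phase_fun \<Rightarrow> real" where
  "S_norm \<beta> F = (SUP (t, x, v)\<in>{0..} \<times> UNIV \<times> UNIV.
     exp (\<beta> * ((norm x)\<^sup>2 + (norm v)\<^sup>2)) * \<bar>F t x v\<bar>)"

definition S_ball :: "real \<Rightarrow> real \<Rightarrow> phase_fun set" where
  "S_ball \<beta> R = {F \<in> S_space \<beta>. S_norm \<beta> F \<le> R}"

definition datum_space :: "real \<Rightarrow> (real^3 \<Rightarrow> real^3 \<Rightarrow> real) set" where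
  "datum_space \<beta> = {F0. continuous_on UNIV (\<lambda>(x, v). F0 x v) \<and>
     (\<exists>c>0. \<forall>x v. \<bar>F0 x v\<bar> \<le> c * exp (- \<beta> * ((norm x)\<^sup>2 + (norm v)\<^sup>2)))}"

definition datum_norm :: "real \<Rightarrow> (real^3 \<Rightarrow> real^3 \<Rightarrow> real) \<Rightarrow> real" where
  "datum_norm \<beta> F0 = (SUP (x, v). exp (\<beta> * ((norm x)\<^sup>2 + (norm v)\<^sup>2)) * \<bar>F0 x v\<bar>)"

text \<open>
  Membership of a solution in \<open>S\<close> (and in \<open>S_R\<close>) is a condition on its profile along
  characteristics \<open>sharp F\<close>, the unknown of the integral equation.  Demanded of \<open>F\<close> itself it would
  exclude free transport, \<open>F t x v = F0 (x - t v) v\<close>, which does not decay in \<open>x\<close> uniformly in \<open>t\<close>.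
  Continuity of \<open>F\<close> and of \<open>sharp F\<close> are equivalent.
\<close>
definition mild_solution ::
    "real \<Rightarrow> real \<Rightarrow> (real^3 \<Rightarrow> real^3 \<Rightarrow> real) \<Rightarrow> phase_fun \<Rightarrow> bool" where
  "mild_solution \<theta> \<beta> F0 F \<longleftrightarrow>
     sharp F \<in> S_space \<beta> \<and>
     (\<forall>t\<ge>0. \<forall>x v. sharp F t x v =
        F0 x v + (LINT \<tau>:{0..t}|lborel. sharp (Qcoll \<theta> F) \<tau> x v))"

text \<open>The class of solutions of the fermionic problem (\<open>\<theta> = -1\<close>) in which uniqueness is asserted.\<close>
definition fermion_solution ::
    "real \<Rightarrow> real \<Rightarrow> (real^3 \<Rightarrow> real^3 \<Rightarrow> real) \<Rightarrow> phase_fun \<Rightarrow> bool" where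
  "fermion_solution \<beta> R F0 F \<longleftrightarrow>
     mild_solution (- 1) \<beta> F0 F \<and> sharp F \<in> S_ball \<beta> R \<and> (\<forall>t\<ge>0. \<forall>x v. F t x v \<ge> 0)"

end

theory Submission
  imports Defs "HOL-Probability.Distributions"
begin

text \<open>
  Along characteristics the unknown is compared with the weight
  \<open>exp (- \<beta> (|x - t v|\<^sup>2 + |v|\<^sup>2))\<close>. Collisions conserve momentum and energy, so the
  gain and loss terms carry the same product of weights, and the time integral of the collision term
  disperses: integrating the relative speed along the relative motion leaves a bound independent of
  time. This makes the integral operator a contraction with factor \<open>O((R + R\<^sup>2) / \<beta>\<^sup>2)\<close>.

  For positivity the equation is first solved with \<open>F\<close> replaced by its positive part inside the
  collision term. Wherever this solution is negative its positive part vanishes, hence the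
  collision term there is a pure gain, which is nonnegative as long as \<open>F \<le> 1\<close>. So the profile
  increases whenever it is below zero and cannot become negative. To have \<open>F \<le> 1\<close> the solution is
  constructed in the ball of radius \<open>min R\<^sub>0 1\<close>, while uniqueness holds in the ball of radius \<open>R\<^sub>0\<close>.
\<close>

section \<open>The sphere measure, Gaussian integrals and parameter integrals\<close>

lemma measurable_sgn_sphere:
  "sgn \<in> measurable (restrict_space lborel (ball 0 1 - {0::real^3})) (restrict_space borel (sphere 0 1))"
proof (rule measurable_restrict_space2)
  show "sgn \<in> borel_measurable (restrict_space lborel (ball 0 1 - {0::real^3}))"
    by (rule measurable_restrict_space1) (simp add: borel_measurable_sgn)
qed (auto simp: space_restrict_space norm_sgn)

lemma space_sphere_measure: "space sphere_measure = sphere 0 1"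
  by (simp add: sphere_measure_def space_scale_measure space_restrict_space)

lemma finite_measure_sphere: "finite_measure sphere_measure"
proof -
  have "emeasure lborel (ball 0 1 - {0::real^3}) < \<infinity>"
    by (rule order.strict_trans1[OF emeasure_mono emeasure_lborel_ball_finite[of 0 1]]) auto
  then have "finite_measure (restrict_space lborel (ball 0 1 - {0::real^3}))"
    by (intro finite_measureI) (simp add: emeasure_restrict_space space_restrict_space)
  then interpret finite_measure "distr (restrict_space lborel (ball 0 1 - {0::real^3})) (restrict_space borel (sphere 0 1)) sgn"
    by (rule finite_measure.finite_measure_distr) (rule measurable_sgn_sphere)
  show ?thesis
    by (rule finite_measureI)
      (use emeasure_finite in \<open>auto simp: sphere_measure_def ennreal_mult_eq_top_iff space_scale_measure\<close>)
qed

interpretation sphere: finite_measure sphere_measure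
  by (rule finite_measure_sphere)

lemma borel_measurable_sphere_measure:
  fixes f :: "real^3 \<Rightarrow> real"
  assumes "continuous_on UNIV f"
  shows "f \<in> borel_measurable sphere_measure"
proof -
  have "f \<in> borel_measurable (restrict_space borel (sphere 0 1))"
    by (intro measurable_restrict_space1 borel_measurable_continuous_onI assms)
  then show ?thesis
    by (simp add: sphere_measure_def cong: measurable_cong_sets)
qed

section \<open>Gaussian integrals on the line, in velocity space and along a moving point\<close>

lemma nn_integral_gaussian_real:
  fixes \<beta> :: real
  assumes "\<beta> > 0"
  shows "(\<integral>\<^sup>+s. exp (- \<beta> * s\<^sup>2) \<partial>lborel) = sqrt (pi / \<beta>)"
proof -
  \<comment> \<open>With variance 1/(2\<beta>) the normal density has exponent -\<beta> s^2, so its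
    total mass 1 gives the integral.\<close>
  define \<sigma> where "\<sigma> = sqrt (1 / (2 * \<beta>))"
  have \<sigma>: "\<sigma> > 0" "2 * \<sigma>\<^sup>2 = 1 / \<beta>" using assms by (auto simp: \<sigma>_def)
  have eq: "exp (- \<beta> * s\<^sup>2) = sqrt (pi / \<beta>) * normal_density 0 \<sigma> s" for s
  proof -
    have "2 * pi * \<sigma>\<^sup>2 = pi / \<beta>" using \<sigma>(2) by (simp add: field_simps)
    then show ?thesis using assms unfolding normal_density_def
      by (simp only: \<sigma>(2)) (simp add: field_simps)
  qed
  have "(\<integral>\<^sup>+s. exp (- \<beta> * s\<^sup>2) \<partial>lborel) = ennreal (\<integral>s. sqrt (pi / \<beta>) * normal_density 0 \<sigma> s \<partial>lborel)"
    unfolding eq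
    by (intro nn_integral_eq_integral integrable_mult_right integrable_normal_density \<sigma>(1) AE_I2) (use assms in simp)
  also have "\<dots> = sqrt (pi / \<beta>)"
    using \<sigma> by simp
  finally show ?thesis .
qed

text \<open>The Gaussian factorises over the coordinates, which gives one one-dimensional integral
  per dimension.\<close>

lemma nn_integral_gaussian_vec:
  fixes \<beta> :: real
  assumes "\<beta> > 0"
  shows "(\<integral>\<^sup>+u. exp (- \<beta> * (norm u)\<^sup>2) \<partial>(lborel :: (real^3) measure)) = ennreal (sqrt (pi / \<beta>) ^ 3)"
proof -
  have eq: "ennreal (exp (- \<beta> * (norm u)\<^sup>2)) = (\<Prod>b\<in>Basis. ennreal (exp (- \<beta> * (u \<bullet> b)\<^sup>2)))" for u :: "real^3"
  proof -
    have "(norm u)\<^sup>2 = (\<Sum>b\<in>Basis. (u \<bullet> b)\<^sup>2)"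
      unfolding power2_norm_eq_inner by (subst euclidean_inner) (simp add: power2_eq_square)
    then show ?thesis by (simp add: prod_ennreal exp_sum sum_distrib_left flip: sum_negf)
  qed
  have "(\<integral>\<^sup>+u. (\<Prod>b\<in>Basis. ennreal (exp (- \<beta> * (u \<bullet> b)\<^sup>2))) \<partial>(lborel :: (real^3) measure))
     = (\<Prod>b\<in>(Basis::(real^3) set). (\<integral>\<^sup>+s. ennreal (exp (- \<beta> * s\<^sup>2)) \<partial>lborel))"
    by (rule nn_integral_lborel_prod) auto
  also have "\<dots> = ennreal (sqrt (pi / \<beta>) ^ 3)"
    using assms by (simp only: nn_integral_gaussian_real[OF assms]) (simp add: ennreal_power)
  finally show ?thesis unfolding eq .
qed

lemma integrable_gaussian_vec:
  "\<beta> > 0 \<Longrightarrow> integrable lborel (\<lambda>u::real^3. exp (- \<beta> * (norm u)\<^sup>2))"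
  by (rule integrableI_nonneg) (use nn_integral_gaussian_vec[of \<beta>] in auto)

text \<open>By Cauchy-Schwarz the norm of \<open>x + \<tau> *\<^sub>R w\<close> is at least the
  absolute value of its component along \<open>w\<close>, which is affine in \<tau> with slope
  \<open>norm w\<close>. Taking this component as the variable absorbs the factor
  \<open>norm w\<close>, hence a bound uniform in \<open>x\<close> and \<open>w\<close>. This is the
  source of the dispersion.\<close>

lemma nn_integral_gaussian_line:
  fixes x w :: "real^3"
  assumes \<beta>: "\<beta> > 0"
  shows "(\<integral>\<^sup>+\<tau>. ennreal (norm w * exp (- \<beta> * (norm (x + \<tau> *\<^sub>R w))\<^sup>2)) \<partial>lborel) \<le> sqrt (pi / \<beta>)"
proof (cases "w = 0")
  case True
  then show ?thesis using \<beta> by simp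
next
  case False
  define p where "p = (x \<bullet> w) / norm w"
  have "(p + norm w * \<tau>)\<^sup>2 \<le> (norm (x + \<tau> *\<^sub>R w))\<^sup>2" for \<tau>
  proof -
    have "(x + \<tau> *\<^sub>R w) \<bullet> w = norm w * (p + norm w * \<tau>)"
      using False by (simp add: p_def algebra_simps inner_add_left flip: power2_norm_eq_inner power2_eq_square)
    then have "norm w * \<bar>p + norm w * \<tau>\<bar> \<le> norm (x + \<tau> *\<^sub>R w) * norm w"
      using Cauchy_Schwarz_ineq2[of "x + \<tau> *\<^sub>R w" w] by (simp add: abs_mult)
    then have "\<bar>p + norm w * \<tau>\<bar> \<le> norm (x + \<tau> *\<^sub>R w)" using False by (simp add: mult.commute)
    then show ?thesis by (metis abs_ge_zero power2_abs power_mono)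
  qed
  then have "(\<integral>\<^sup>+\<tau>. ennreal (norm w * exp (- \<beta> * (norm (x + \<tau> *\<^sub>R w))\<^sup>2)) \<partial>lborel)
    \<le> (\<integral>\<^sup>+\<tau>. ennreal (norm w) * ennreal (exp (- \<beta> * (p + norm w * \<tau>)\<^sup>2)) \<partial>lborel)"
    using \<beta> by (intro nn_integral_mono) (auto simp flip: ennreal_mult intro!: ennreal_leI mult_left_mono)
  also have "\<dots> = norm w * (\<integral>\<^sup>+\<tau>. ennreal (exp (- \<beta> * (p + norm w * \<tau>)\<^sup>2)) \<partial>lborel)"
    by (rule nn_integral_cmult) measurable
  also have "\<dots> = (\<integral>\<^sup>+s. ennreal (exp (- \<beta> * s\<^sup>2)) \<partial>lborel)"
    using False by (subst nn_integral_real_affine[where c="norm w" and t=p]) auto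
  finally show ?thesis by (simp only: nn_integral_gaussian_real[OF \<beta>])
qed

section \<open>Integrals depending on a parameter or on their endpoint\<close>

lemma continuous_on_integral_dominated:
  fixes f :: "'p::metric_space \<Rightarrow> 'a \<Rightarrow> real"
  assumes cont: "\<And>x. x \<in> space M \<Longrightarrow> continuous_on S (\<lambda>p. f p x)"
    and meas: "\<And>p. p \<in> S \<Longrightarrow> f p \<in> borel_measurable M"
    and w: "integrable M w" and bound: "\<And>p x. p \<in> S \<Longrightarrow> x \<in> space M \<Longrightarrow> \<bar>f p x\<bar> \<le> w x"
  shows "continuous_on S (\<lambda>p. LINT x|M. f p x)"
proof (unfold continuous_on_sequentially, intro allI ballI impI, clarify)
  fix s p assume p: "p \<in> S" and s: "\<forall>n. s n \<in> S" "s \<longlonglongrightarrow> p"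
  have "(\<lambda>n. LINT x|M. f (s n) x) \<longlonglongrightarrow> (LINT x|M. f p x)"
  proof (rule integral_dominated_convergence[OF _ _ w])
    show "AE x in M. (\<lambda>n. f (s n) x) \<longlonglongrightarrow> f p x"
    proof (rule AE_I2)
      fix x assume "x \<in> space M"
      from cont[OF this] p s show "(\<lambda>n. f (s n) x) \<longlonglongrightarrow> f p x"
        unfolding continuous_on_sequentially by (auto simp: o_def)
    qed
  qed (use p s meas bound in auto)
  then show "((\<lambda>p. LINT x|M. f p x) \<circ> s) \<longlonglongrightarrow> (LINT x|M. f p x)" by (simp add: o_def)
qed

lemma set_integral_point: "(LINT x:{a..a}|lborel. f x) = 0" for a :: real and f :: "real \<Rightarrow> real"
  unfolding set_lebesgue_integral_def
  by (rule integral_eq_zero_AE, rule AE_mp[OF AE_lborel_singleton[of a]]) simp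

text \<open>The endpoint \<open>max t 0\<close> yields a function continuous at all real times, as
  needed for a fixed point argument among bounded continuous functions on the whole space.\<close>

lemma continuous_on_time_integral:
  fixes q :: "real \<Rightarrow> 'p::metric_space \<Rightarrow> real"
  assumes cont: "continuous_on ({0..} \<times> UNIV) (\<lambda>(\<tau>, p). q \<tau> p)"
    and bound: "\<And>\<tau> p. \<tau> \<ge> 0 \<Longrightarrow> \<bar>q \<tau> p\<bar> \<le> B"
  shows "continuous_on UNIV (\<lambda>(t, p). LINT \<tau>:{0..max t 0}|lborel. q \<tau> p)"
proof -
  have q: "continuous_on S (\<lambda>s. q (f s) (g s))"
    if "continuous_on S f" "continuous_on S g" "\<And>s. s \<in> S \<Longrightarrow> 0 \<le> f s" for S :: "'s::metric_space set" and f g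
  proof -
    have "continuous_on S (\<lambda>s. (f s, g s))" by (intro continuous_on_Pair that)
    moreover have "(\<lambda>s. (f s, g s)) ` S \<subseteq> {0..} \<times> UNIV" using that by auto
    ultimately show ?thesis using continuous_on_compose2[OF cont] by fastforce
  qed
  \<comment> \<open>The substitution \<open>\<tau> = t * s\<close> moves the variable endpoint into
    an integrand over the fixed interval [0,1], where dominated convergence applies. It degenerates
    at t = 0, which is treated apart.\<close>
  have scale: "(LINT \<tau>:{0..t}|lborel. q \<tau> p) = t * (LINT s|lborel. indicator {0..1} s * q (t * s) p)" if "0 \<le> t" for t p
  proof (cases "t = 0")
    case True
    have "(LINT \<tau>:{0..0::real}|lborel. q \<tau> p) = 0"
      by (rule set_integral_point)
    then show ?thesis using True by simp
  next
    case False
    have "(LINT \<tau>:{0..t}|lborel. q \<tau> p) = \<bar>t\<bar> *\<^sub>R (LINT s|lborel. indicator {0..t} (0 + t * s) *\<^sub>R q (0 + t * s) p)"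
      unfolding set_lebesgue_integral_def by (rule lborel_integral_real_affine[OF False])
    then have "(LINT \<tau>:{0..t}|lborel. q \<tau> p) = t * (LINT s|lborel. indicator {0..t} (t * s) * q (t * s) p)"
      using that by simp
    also have "(\<lambda>s. indicator {0..t} (t * s) * q (t * s) p) = (\<lambda>s. indicator {0..1} s * q (t * s) p)"
    proof
      fix s
      have "t * s \<in> {0..t} \<longleftrightarrow> s \<in> {0..1}"
        using that False by (simp add: zero_le_mult_iff mult_le_cancel_left1)
      then show "indicator {0..t} (t * s) * q (t * s) p = indicator {0..1} s * q (t * s) p"
        by (simp only: indicator_def)
    qed
    finally show ?thesis .
  qed
  have "continuous_on UNIV (\<lambda>z. LINT s|lborel. indicator {0..1} s * q (max (fst z) 0 * s) (snd z))"
  proof (rule continuous_on_integral_dominated)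
    show "integrable lborel (\<lambda>s::real. indicator {0..1} s * B)"
      by (intro integrable_mult_left integrable_real_indicator) auto
    show "continuous_on UNIV (\<lambda>z. indicator {0..1} s * q (max (fst z) 0 * s) (snd z))" for s :: real
      by (cases "s \<in> {0..1}") (auto intro!: q continuous_intros)
    show "(\<lambda>s. indicator {0..1} s * q (max (fst z) 0 * s) (snd z)) \<in> borel_measurable lborel" for z
    proof -
      have "continuous_on {0..1} (\<lambda>s. q (max (fst z) 0 * s) (snd z))"
        by (intro q continuous_intros) auto
      then have "(\<lambda>s. indicator {0..1} s *\<^sub>R q (max (fst z) 0 * s) (snd z)) \<in> borel_measurable borel"
        by (intro borel_measurable_continuous_on_indicator) auto
      then show ?thesis by simp
    qed
    show "\<bar>indicator {0..1} s * q (max (fst z) 0 * s) (snd z)\<bar> \<le> indicator {0..1} s * B" for z and s :: real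
      using bound[of "max (fst z) 0 * s" "snd z"] by (auto split: split_indicator)
  qed
  then have "continuous_on UNIV (\<lambda>z. max (fst z) 0 * (LINT s|lborel. indicator {0..1} s * q (max (fst z) 0 * s) (snd z)))"
    by (intro continuous_intros)
  then show ?thesis by (simp add: case_prod_unfold scale)
qed

text \<open>If g t were negative, there would be a last time s before t with
  \<open>g s \<ge> 0\<close>. On the interval from s to t the function is negative, so q is
  nonnegative there and \<open>g s \<le> g t\<close>, a contradiction.\<close>

lemma nonneg_if_increasing_below_zero:
  fixes q g :: "real \<Rightarrow> real"
  assumes int: "\<And>t. t \<ge> 0 \<Longrightarrow> set_integrable lborel {0..t} q"
    and g: "\<And>t. t \<ge> 0 \<Longrightarrow> g t = c + (LINT \<tau>:{0..t}|lborel. q \<tau>)"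
    and cont: "continuous_on {0..} g" and c: "0 \<le> c"
    and incr: "\<And>\<tau>. \<tau> \<ge> 0 \<Longrightarrow> g \<tau> < 0 \<Longrightarrow> 0 \<le> q \<tau>" and t: "t \<ge> 0"
  shows "0 \<le> g t"
proof (rule ccontr)
  assume "\<not> 0 \<le> g t"
  have "(LINT \<tau>:{0..0::real}|lborel. q \<tau>) = 0" by (rule set_integral_point)
  then have g0: "0 \<le> g 0" using g[of 0] c by simp
  have "closed ({0..t} \<inter> g -` {0..})"
    using continuous_on_subset[OF cont, of "{0..t}"] by (intro continuous_closed_preimage) auto
  then have "compact ({0..t} \<inter> g -` {0..})"
    by (meson bounded_Int bounded_closed_interval compact_eq_bounded_closed)
  moreover have "0 \<in> {0..t} \<inter> g -` {0..}" using g0 t by simp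
  ultimately obtain s where s: "s \<in> {0..t} \<inter> g -` {0..}" and max: "\<And>\<tau>. \<tau> \<in> {0..t} \<inter> g -` {0..} \<Longrightarrow> \<tau> \<le> s"
    using compact_attains_sup by (metis empty_iff)
  have "set_integrable lborel {s<..t} q"
    by (rule set_integrable_subset[OF int[OF t]]) (use s in auto)
  moreover have "{0..t} = {0..s} \<union> {s<..t}" using s by auto
  moreover have "{0..s} \<inter> {s<..t} = {}" by auto
  ultimately have "(LINT \<tau>:{0..t}|lborel. q \<tau>) = (LINT \<tau>:{0..s}|lborel. q \<tau>) + (LINT \<tau>:{s<..t}|lborel. q \<tau>)"
    using int[of s] s set_integral_Un[of "{0..s}" "{s<..t}" lborel q] by simp
  moreover have "0 \<le> (LINT \<tau>:{s<..t}|lborel. q \<tau>)"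
    unfolding set_lebesgue_integral_def
  proof (rule Bochner_Integration.integral_nonneg)
    fix \<tau>
    show "0 \<le> indicator {s<..t} \<tau> *\<^sub>R q \<tau>"
    proof (cases "\<tau> \<in> {s<..t}")
      case True
      then have "\<tau> \<notin> g -` {0..}" using max[of \<tau>] s by auto
      then show ?thesis using incr[of \<tau>] True s by auto
    qed simp
  qed
  ultimately have "g s \<le> g t" using g[of s] g[OF t] s by simp
  then show False using s \<open>\<not> 0 \<le> g t\<close> by simp
qed

section \<open>Estimates on the collision term\<close>

text \<open>The Gaussian of the norm on \<open>S_space\<close>, taken at the foot x - t v of the
  characteristic. Bounding \<open>F\<close> by it amounts to a time-independent Gaussian bound on
  \<open>sharp F\<close>.\<close>

definition weight :: "real \<Rightarrow> real \<Rightarrow> real^3 \<Rightarrow> real^3 \<Rightarrow> real" where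
  "weight \<beta> t x v = exp (- \<beta> * ((norm (x - t *\<^sub>R v))\<^sup>2 + (norm v)\<^sup>2))"

text \<open>Expresses that \<open>sharp F\<close> lies in the ball of radius \<open>R\<close>
  through conditions on \<open>F\<close> itself, with a pointwise bound in place of the
  supremum.\<close>

definition admissible :: "real \<Rightarrow> real \<Rightarrow> phase_fun \<Rightarrow> bool" where
  "admissible \<beta> R F \<longleftrightarrow> continuous_on ({0..} \<times> UNIV \<times> UNIV) (\<lambda>(t, x, v). F t x v) \<and>
     (\<forall>t\<ge>0. \<forall>x v. \<bar>F t x v\<bar> \<le> R * weight \<beta> t x v)"

definition collision_density :: "phase_fun \<Rightarrow> real \<Rightarrow> real^3 \<Rightarrow> real^3 \<Rightarrow> real^3 \<Rightarrow> real^3 \<Rightarrow> real" where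
  "collision_density F t x v u \<omega> = \<bar>\<omega> \<bullet> (v - u)\<bar> *
     (F t x (post_u \<omega> u v) * F t x (post_v \<omega> u v) * (1 - F t x u - F t x v)
      - F t x u * F t x v * (1 - F t x (post_u \<omega> u v) - F t x (post_v \<omega> u v)))"

lemma Qcoll_fermion:
  "Qcoll (- 1) F t x v = (LINT u|lborel. LINT \<omega>|sphere_measure. collision_density F t x v u \<omega>)"
  by (simp add: Qcoll_def collision_density_def Let_def)

lemma weight_pos: "0 < weight \<beta> t x v"
  and weight_le_1: "\<beta> > 0 \<Longrightarrow> weight \<beta> t x v \<le> 1"
  by (auto simp: weight_def)

lemma collision_energy:
  assumes "norm \<omega> = 1"
  shows "(norm (post_u \<omega> u v))\<^sup>2 + (norm (post_v \<omega> u v))\<^sup>2 = (norm u)\<^sup>2 + (norm v)\<^sup>2"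
proof -
  have "\<omega> \<bullet> \<omega> = 1" using assms by (simp add: norm_eq_1)
  then show ?thesis
    unfolding power2_norm_eq_inner post_u_def post_v_def
    by (simp add: inner_add_left inner_add_right inner_diff_left inner_diff_right inner_commute algebra_simps)
qed

text \<open>Free transport maps the collision of \<open>u\<close>, \<open>v\<close> to that of \<open>x - t u\<close>, \<open>x - t v\<close>.\<close>
lemma weight_collision:
  assumes "norm \<omega> = 1"
  shows "weight \<beta> t x (post_u \<omega> u v) * weight \<beta> t x (post_v \<omega> u v) = weight \<beta> t x u * weight \<beta> t x v"
proof -
  have "x - t *\<^sub>R post_u \<omega> u v = post_u \<omega> (x - t *\<^sub>R u) (x - t *\<^sub>R v)"
    and "x - t *\<^sub>R post_v \<omega> u v = post_v \<omega> (x - t *\<^sub>R u) (x - t *\<^sub>R v)"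
    by (simp_all add: post_u_def post_v_def inner_diff_right algebra_simps)
  then have "((norm (x - t *\<^sub>R post_u \<omega> u v))\<^sup>2 + (norm (post_u \<omega> u v))\<^sup>2) +
      ((norm (x - t *\<^sub>R post_v \<omega> u v))\<^sup>2 + (norm (post_v \<omega> u v))\<^sup>2) =
    ((norm (x - t *\<^sub>R u))\<^sup>2 + (norm u)\<^sup>2) + ((norm (x - t *\<^sub>R v))\<^sup>2 + (norm v)\<^sup>2)"
    using collision_energy[OF assms, of u v] collision_energy[OF assms, of "x - t *\<^sub>R u" "x - t *\<^sub>R v"]
    by simp
  then show ?thesis
    by (simp only: weight_def exp_add[symmetric] distrib_left[symmetric])
qed

section \<open>Lipschitz estimates for the collision integrand\<close>

lemma mult_diff_bound:
  fixes a b c d :: real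
  assumes "\<bar>a\<bar> \<le> R * A" "\<bar>d\<bar> \<le> S * B" "\<bar>a - c\<bar> \<le> D * A" "\<bar>b - d\<bar> \<le> E * B" "0 \<le> A" "0 \<le> B"
  shows "\<bar>a * b - c * d\<bar> \<le> (R * E + D * S) * (A * B)"
proof -
  \<comment> \<open>Telescoping: one factor is exchanged at a time, so both weights survive in each
    term.\<close>
  have "\<bar>a * b - c * d\<bar> = \<bar>a * (b - d) + (a - c) * d\<bar>" by (simp add: algebra_simps)
  also have "\<dots> \<le> \<bar>a\<bar> * \<bar>b - d\<bar> + \<bar>a - c\<bar> * \<bar>d\<bar>" using abs_triangle_ineq by (simp flip: abs_mult)
  also have "\<dots> \<le> (R * A) * (E * B) + (D * A) * (S * B)"
    using assms by (intro add_mono mult_mono) (auto intro: order_trans[OF abs_ge_zero])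
  finally show ?thesis by (simp add: algebra_simps)
qed

text \<open>Expanded, the bracket has two quadratic and four cubic terms. Exchanging the factors one
  by one costs \<open>2 * R * D\<close> for a quadratic term and \<open>3 * R\<^sup>2 * D\<close>
  for a cubic one, each times \<open>A * B\<close>; the sum is the stated constant. The conservation
  law \<open>A' * B' = A * B\<close> lets gain and loss terms share this weight.\<close>

lemma fermion_collision_diff_bound:
  fixes a b a' b' c d c' d' R D A B A' B' :: real
  assumes bounds: "\<bar>a\<bar> \<le> R * A" "\<bar>b\<bar> \<le> R * B" "\<bar>a'\<bar> \<le> R * A'" "\<bar>b'\<bar> \<le> R * B'"
      "\<bar>c\<bar> \<le> R * A" "\<bar>d\<bar> \<le> R * B" "\<bar>c'\<bar> \<le> R * A'" "\<bar>d'\<bar> \<le> R * B'"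
    and diffs: "\<bar>a - c\<bar> \<le> D * A" "\<bar>b - d\<bar> \<le> D * B" "\<bar>a' - c'\<bar> \<le> D * A'" "\<bar>b' - d'\<bar> \<le> D * B'"
    and w: "0 \<le> A" "A \<le> 1" "0 \<le> B" "B \<le> 1" "0 \<le> A'" "A' \<le> 1" "0 \<le> B'" "B' \<le> 1"
    and AB: "A' * B' = A * B" and R: "0 \<le> R" "0 \<le> D"
  shows "\<bar>(a' * b' * (1 - a - b) - a * b * (1 - a' - b')) - (c' * d' * (1 - c - d) - c * d * (1 - c' - d'))\<bar>
    \<le> (4 * R + 12 * R\<^sup>2) * D * (A * B)"
proof -
  define M where "M = A * B"
  have M: "0 \<le> M" "M = A' * B'" using w AB by (auto simp: M_def)
  \<comment> \<open>\<open>P\<close> and \<open>Q\<close> are the pair of weights that is kept,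
    primed or unprimed; the weight \<open>S\<close> of the third factor is estimated by 1.\<close>
  have triple: "\<bar>p * q * r - p' * q' * r'\<bar> \<le> 3 * R\<^sup>2 * D * M"
    if "\<bar>p\<bar> \<le> R * P" "\<bar>q\<bar> \<le> R * Q" "\<bar>q'\<bar> \<le> R * Q" "\<bar>r'\<bar> \<le> R * S"
      "\<bar>p - p'\<bar> \<le> D * P" "\<bar>q - q'\<bar> \<le> D * Q" "\<bar>r - r'\<bar> \<le> D * S"
      "P * Q = M" "0 \<le> P" "0 \<le> Q" "0 \<le> S" "S \<le> 1"
    for p q r p' q' r' P Q S
  proof -
    have "\<bar>p * q\<bar> \<le> R * P * (R * Q)"
      unfolding abs_mult by (rule mult_mono[OF that(1,2)]) (use that R in simp_all)
    then have "\<bar>p * q\<bar> \<le> R * R * (P * Q)"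
      by (simp only: mult_ac)
    moreover have "\<bar>p * q - p' * q'\<bar> \<le> (R * D + D * R) * (P * Q)"
      by (rule mult_diff_bound[OF that(1,3,5,6,9,10)])
    ultimately have "\<bar>p * q * r - p' * q' * r'\<bar> \<le> (R * R * D + (R * D + D * R) * R) * (P * Q * S)"
      by (rule mult_diff_bound[OF _ that(4) _ that(7) _ that(11)]) (use that M(1) in simp)
    also have "\<dots> = 3 * R\<^sup>2 * D * M * S" using that by (simp add: power2_eq_square algebra_simps)
    also have "\<dots> \<le> 3 * R\<^sup>2 * D * M" by (rule mult_left_le[OF that(12)]) (intro mult_nonneg_nonneg R M(1); simp)
    finally show ?thesis .
  qed
  have "\<bar>a' * b' - c' * d'\<bar> \<le> (R * D + D * R) * (A' * B')" "\<bar>a * b - c * d\<bar> \<le> (R * D + D * R) * (A * B)"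
    by (rule mult_diff_bound[OF bounds(3,8) diffs(3,4) w(5,7)], rule mult_diff_bound[OF bounds(1,6) diffs(1,2) w(1,3)])
  then have "\<bar>a' * b' - c' * d'\<bar> \<le> 2 * R * D * M" "\<bar>a * b - c * d\<bar> \<le> 2 * R * D * M"
    by (simp_all add: M_def AB algebra_simps)
  moreover have "\<bar>a' * b' * a - c' * d' * c\<bar> \<le> 3 * R\<^sup>2 * D * M" "\<bar>a' * b' * b - c' * d' * d\<bar> \<le> 3 * R\<^sup>2 * D * M"
    by (rule triple[OF bounds(3,4,8,5) diffs(3,4,1) M(2)[symmetric] w(5,7,1,2)],
        rule triple[OF bounds(3,4,8,6) diffs(3,4,2) M(2)[symmetric] w(5,7,3,4)])
  moreover have "\<bar>a * b * a' - c * d * c'\<bar> \<le> 3 * R\<^sup>2 * D * M" "\<bar>a * b * b' - c * d * d'\<bar> \<le> 3 * R\<^sup>2 * D * M"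
    by (rule triple[OF bounds(1,2,6,7) diffs(1,2,3) M_def[symmetric] w(1,3,5,6)],
        rule triple[OF bounds(1,2,6,8) diffs(1,2,4) M_def[symmetric] w(1,3,7,8)])
  ultimately have "\<bar>(a' * b' * (1 - a - b) - a * b * (1 - a' - b')) - (c' * d' * (1 - c - d) - c * d * (1 - c' - d'))\<bar>
    \<le> 2 * (2 * R * D * M) + 4 * (3 * R\<^sup>2 * D * M)"
    unfolding right_diff_distrib mult_1_right by linarith
  then show ?thesis by (simp add: M_def algebra_simps)
qed

text \<open>Conservation of the weights in a collision permits the algebraic estimate, and
  Cauchy-Schwarz replaces the kernel by the relative speed. The bound no longer depends on \<omega>,
  so the sphere integral will contribute only the area of the sphere.\<close>

lemma collision_density_diff_bound:
  assumes F: "admissible \<beta> R F" and G: "admissible \<beta> R G"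
    and D: "\<And>v. \<bar>F t x v - G t x v\<bar> \<le> D * weight \<beta> t x v"
    and t: "t \<ge> 0" and \<omega>: "norm \<omega> = 1" and \<beta>: "\<beta> > 0"
  shows "\<bar>collision_density F t x v u \<omega> - collision_density G t x v u \<omega>\<bar>
    \<le> (4 * R + 12 * R\<^sup>2) * D * (norm (v - u) * (weight \<beta> t x u * weight \<beta> t x v))"
proof -
  have FG: "\<bar>F t x w\<bar> \<le> R * weight \<beta> t x w" "\<bar>G t x w\<bar> \<le> R * weight \<beta> t x w" for w
    using F G t by (auto simp: admissible_def)
  have "0 \<le> R * weight \<beta> t x v" "0 \<le> D * weight \<beta> t x v"
    using FG(1)[of v] D[of v] by linarith+
  then have R: "0 \<le> R" "0 \<le> D"
    using weight_pos[of \<beta> t x v] by (auto simp: zero_le_mult_iff)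
  let ?W = "weight \<beta> t x" and ?u = "post_u \<omega> u v" and ?v = "post_v \<omega> u v"
  let ?C = "\<lambda>F. F t x ?u * F t x ?v * (1 - F t x u - F t x v) - F t x u * F t x v * (1 - F t x ?u - F t x ?v)"
  have "\<bar>?C F - ?C G\<bar> \<le> (4 * R + 12 * R\<^sup>2) * D * (?W u * ?W v)"
    by (rule fermion_collision_diff_bound[OF FG(1) FG(1) FG(1) FG(1) FG(2) FG(2) FG(2) FG(2) D D D D])
      (simp_all only: weight_collision[OF \<omega>] weight_le_1[OF \<beta>] less_imp_le[OF weight_pos] R)
  moreover have "\<bar>\<omega> \<bullet> (v - u)\<bar> \<le> norm (v - u)"
    using Cauchy_Schwarz_ineq2[of \<omega> "v - u"] \<omega> by simp
  ultimately have "\<bar>\<omega> \<bullet> (v - u)\<bar> * \<bar>?C F - ?C G\<bar> \<le> norm (v - u) * ((4 * R + 12 * R\<^sup>2) * D * (?W u * ?W v))"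
    by (intro mult_mono) auto
  moreover have "\<bar>collision_density F t x v u \<omega> - collision_density G t x v u \<omega>\<bar> = \<bar>\<omega> \<bullet> (v - u)\<bar> * \<bar>?C F - ?C G\<bar>"
    unfolding collision_density_def right_diff_distrib[symmetric, of "\<bar>\<omega> \<bullet> (v - u)\<bar>"] abs_mult abs_abs ..
  ultimately show ?thesis by (simp only: mult_ac)
qed

text \<open>Comparison with the zero function turns the difference estimates into bounds for a
  single function.\<close>

lemma admissible_zero: "0 \<le> R \<Longrightarrow> admissible \<beta> R (\<lambda>_ _ _. 0)"
  by (simp add: admissible_def case_prod_unfold less_imp_le[OF weight_pos])

section \<open>Integrability and continuity of the collision term\<close>

lemma admissible_continuous_on:
  assumes "admissible \<beta> R F" "continuous_on S f" "continuous_on S g" "continuous_on S h" "\<And>s. s \<in> S \<Longrightarrow> 0 \<le> f s"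
  shows "continuous_on S (\<lambda>s. F (f s) (g s) (h s))"
proof -
  have "continuous_on ({0..} \<times> UNIV \<times> UNIV) (\<lambda>(t, x, v). F t x v)"
    using assms(1) by (simp add: admissible_def)
  moreover have "continuous_on S (\<lambda>s. (f s, g s, h s))"
    by (intro continuous_on_Pair assms(2-4))
  moreover have "(\<lambda>s. (f s, g s, h s)) ` S \<subseteq> {0..} \<times> UNIV \<times> UNIV"
    using assms(5) by auto
  ultimately show ?thesis by (auto dest: continuous_on_compose2)
qed

lemma collision_density_continuous_on:
  assumes "admissible \<beta> R F" "continuous_on S f" "continuous_on S g" "continuous_on S h" "continuous_on S k"
    "continuous_on S l" "\<And>s. s \<in> S \<Longrightarrow> 0 \<le> f s"
  shows "continuous_on S (\<lambda>s. collision_density F (f s) (g s) (h s) (k s) (l s))"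
  unfolding collision_density_def post_u_def post_v_def
  using assms(2-7) by (intro continuous_intros admissible_continuous_on[OF assms(1)]) auto

text \<open>Each Gaussian is split into two equal halves. One half of each absorbs the relative
  speed, which is at most the sum of the two norms; of the remaining halves the one in
  \<open>u\<close> is kept for integrability and the one in \<open>v\<close> is estimated by
  1.\<close>

lemma relative_speed_gaussian_bound:
  fixes u v :: "'a::real_normed_vector"
  assumes \<beta>: "\<beta> > 0"
  shows "norm (v - u) * (exp (- \<beta> * (norm u)\<^sup>2) * exp (- \<beta> * (norm v)\<^sup>2))
    \<le> (2 + 2 / \<beta>) * exp (- (\<beta> / 2) * (norm u)\<^sup>2)"
proof -
  \<comment> \<open>The constant comes from \<open>2 * y \<le> 1 + y\<^sup>2\<close> together with
    the lower bound 1 + z for exp z at z = \<beta> y^2 / 2.\<close>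
  have lin: "y * exp (- (\<beta> / 2) * y\<^sup>2) \<le> 1 + 1 / \<beta>" if "0 \<le> y" for y :: real
  proof -
    have "y \<le> (1 + 1 / \<beta>) * (1 + \<beta> / 2 * y\<^sup>2)"
    proof -
      have "(1 + 1 / \<beta>) * (1 + \<beta> / 2 * y\<^sup>2) = 1 + 1 / \<beta> + \<beta> / 2 * y\<^sup>2 + y\<^sup>2 / 2"
        using \<beta> by (simp add: field_simps)
      moreover have "2 * y \<le> 1 + y\<^sup>2" using sum_squares_bound[of 1 y] by (simp add: power2_eq_square)
      moreover have "0 \<le> 1 / \<beta>" "0 \<le> \<beta> / 2 * y\<^sup>2" using \<beta> by auto
      ultimately show ?thesis by linarith
    qed
    also have "\<dots> \<le> (1 + 1 / \<beta>) * exp (\<beta> / 2 * y\<^sup>2)"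
      using \<beta> exp_ge_add_one_self[of "\<beta> / 2 * y\<^sup>2"] by (intro mult_left_mono) auto
    finally show ?thesis by (simp add: exp_minus field_simps)
  qed
  define e where "e y = exp (- (\<beta> / 2) * y\<^sup>2)" for y :: real
  have e: "0 < e y" "e y \<le> 1" "exp (- \<beta> * y\<^sup>2) = e y * e y" for y
    using \<beta> by (auto simp: e_def simp flip: exp_add)
  have "norm (v - u) * (e (norm u) * e (norm v)) \<le> (norm v + norm u) * (e (norm u) * e (norm v))"
    using e by (intro mult_right_mono norm_triangle_ineq4) (simp add: less_imp_le)
  also have "\<dots> = (norm v * e (norm v)) * e (norm u) + (norm u * e (norm u)) * e (norm v)"
    by (simp add: algebra_simps)
  also have "\<dots> \<le> (1 + 1 / \<beta>) * 1 + (1 + 1 / \<beta>) * 1"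
    using lin[of "norm u"] lin[of "norm v"] e \<beta>
    by (intro add_mono mult_mono) (auto simp: e_def less_imp_le)
  finally have *: "norm (v - u) * (e (norm u) * e (norm v)) \<le> 2 + 2 / \<beta>" by simp
  have "norm (v - u) * (exp (- \<beta> * (norm u)\<^sup>2) * exp (- \<beta> * (norm v)\<^sup>2))
    = (norm (v - u) * (e (norm u) * e (norm v))) * (e (norm u) * e (norm v))"
    unfolding e by (simp add: algebra_simps)
  also have "\<dots> \<le> (2 + 2 / \<beta>) * (e (norm u) * 1)"
    using * e \<beta> by (intro mult_mono) (auto simp: less_imp_le)
  finally show ?thesis by (simp add: e_def)
qed

text \<open>Only the velocity part of the weights is used. The majorant depends on \<open>u\<close>
  alone and so can serve as the dominating function in the velocity integral.\<close>

lemma relative_speed_weight_bound: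
  assumes "\<beta> > 0"
  shows "norm (v - u) * (weight \<beta> t x u * weight \<beta> t x v) \<le> (2 + 2 / \<beta>) * exp (- (\<beta> / 2) * (norm u)\<^sup>2)"
proof -
  have "weight \<beta> t x w \<le> exp (- \<beta> * (norm w)\<^sup>2)" for w
    using assms by (auto simp: weight_def)
  then have "norm (v - u) * (weight \<beta> t x u * weight \<beta> t x v)
    \<le> norm (v - u) * (exp (- \<beta> * (norm u)\<^sup>2) * exp (- \<beta> * (norm v)\<^sup>2))"
    by (intro mult_left_mono mult_mono) (auto simp: less_imp_le[OF weight_pos])
  also note relative_speed_gaussian_bound[OF assms]
  finally show ?thesis .
qed

abbreviation sphere_area :: real where
  "sphere_area \<equiv> measure sphere_measure (space sphere_measure)"

definition collision_rate :: "phase_fun \<Rightarrow> real \<Rightarrow> real^3 \<Rightarrow> real^3 \<Rightarrow> real^3 \<Rightarrow> real" where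
  "collision_rate F t x v u = (LINT \<omega>|sphere_measure. collision_density F t x v u \<omega>)"

lemma admissible_nonneg:
  assumes "admissible \<beta> R F"
  shows "0 \<le> R"
proof -
  have "0 \<le> R * weight \<beta> 0 0 0"
    using assms by (meson abs_ge_zero admissible_def order_refl order_trans)
  then show ?thesis using weight_pos[of \<beta> 0 0 0] by (simp add: zero_le_mult_iff)
qed

lemma collision_density_bound:
  assumes "admissible \<beta> R F" "t \<ge> 0" "norm \<omega> = 1" "\<beta> > 0"
  shows "\<bar>collision_density F t x v u \<omega>\<bar> \<le> (4 * R + 12 * R\<^sup>2) * R * (norm (v - u) * (weight \<beta> t x u * weight \<beta> t x v))"
proof -
  have "\<bar>F t x w - 0\<bar> \<le> R * weight \<beta> t x w" for w
    using assms by (simp add: admissible_def)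
  from collision_density_diff_bound[OF assms(1) admissible_zero[OF admissible_nonneg[OF assms(1)]] this assms(2-4)]
  show ?thesis by (simp add: collision_density_def)
qed

lemma collision_density_bound':
  assumes "admissible \<beta> R F" "t \<ge> 0" "norm \<omega> = 1" "\<beta> > 0"
  shows "\<bar>collision_density F t x v u \<omega>\<bar> \<le> (4 * R + 12 * R\<^sup>2) * R * ((2 + 2 / \<beta>) * exp (- (\<beta> / 2) * (norm u)\<^sup>2))"
proof -
  have "0 \<le> (4 * R + 12 * R\<^sup>2) * R" using admissible_nonneg[OF assms(1)] by simp
  then show ?thesis
    by (intro order_trans[OF collision_density_bound[OF assms]] mult_left_mono relative_speed_weight_bound assms)
qed

lemma borel_measurable_collision_density:
  assumes "admissible \<beta> R F" "t \<ge> 0"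
  shows "collision_density F t x v u \<in> borel_measurable sphere_measure"
  by (intro borel_measurable_sphere_measure collision_density_continuous_on[OF assms(1)] continuous_on_const continuous_on_id assms(2))

lemma integrable_collision_density:
  assumes "admissible \<beta> R F" "t \<ge> 0" "\<beta> > 0"
  shows "integrable sphere_measure (collision_density F t x v u)"
  by (rule sphere.integrable_const_bound[OF AE_I2 borel_measurable_collision_density[OF assms(1,2)]])
    (unfold real_norm_def, rule collision_density_bound[OF assms(1,2) _ assms(3)], simp add: space_sphere_measure)

lemma collision_rate_diff_bound:
  assumes F: "admissible \<beta> R F" and G: "admissible \<beta> R G"
    and D: "\<And>v. \<bar>F t x v - G t x v\<bar> \<le> D * weight \<beta> t x v" and t: "t \<ge> 0" and \<beta>: "\<beta> > 0"
  shows "\<bar>collision_rate F t x v u - collision_rate G t x v u\<bar>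
    \<le> sphere_area * ((4 * R + 12 * R\<^sup>2) * D * (norm (v - u) * (weight \<beta> t x u * weight \<beta> t x v)))"
proof -
  have "\<bar>collision_rate F t x v u - collision_rate G t x v u\<bar>
      = norm (LINT \<omega>|sphere_measure. collision_density F t x v u \<omega> - collision_density G t x v u \<omega>)"
    unfolding collision_rate_def real_norm_def
    by (subst Bochner_Integration.integral_diff) (auto intro!: integrable_collision_density[OF _ t \<beta>] F G)
  also have "\<dots> \<le> (LINT \<omega>|sphere_measure. (4 * R + 12 * R\<^sup>2) * D * (norm (v - u) * (weight \<beta> t x u * weight \<beta> t x v)))"
    by (rule Bochner_Integration.integral_norm_bound_integral)
      (auto intro!: integrable_collision_density[OF _ t \<beta>] F G collision_density_diff_bound[OF F G D t _ \<beta>]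
        simp: space_sphere_measure)
  finally show ?thesis by simp
qed

lemma collision_rate_bound:
  assumes "admissible \<beta> R F" "t \<ge> 0" "\<beta> > 0"
  shows "\<bar>collision_rate F t x v u\<bar> \<le> sphere_area * ((4 * R + 12 * R\<^sup>2) * R * ((2 + 2 / \<beta>) * exp (- (\<beta> / 2) * (norm u)\<^sup>2)))"
proof -
  have "\<bar>collision_rate F t x v u\<bar> \<le>
      (LINT \<omega>|sphere_measure. (4 * R + 12 * R\<^sup>2) * R * ((2 + 2 / \<beta>) * exp (- (\<beta> / 2) * (norm u)\<^sup>2)))"
    unfolding collision_rate_def
    by (rule Bochner_Integration.integral_abs_bound_integral, rule integrable_collision_density[OF assms], simp,
        rule collision_density_bound'[OF assms(1,2) _ assms(3)], simp add: space_sphere_measure)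
  then show ?thesis by simp
qed

text \<open>The sphere has finite measure, so a constant dominates; the Gaussian in
  \<open>collision_density_bound'\<close> is estimated by 1.\<close>

lemma collision_rate_continuous_on:
  assumes F: "admissible \<beta> R F" and \<beta>: "\<beta> > 0"
    and cont: "continuous_on S f" "continuous_on S g" "continuous_on S h" "continuous_on S k"
    and nonneg: "\<And>s. s \<in> S \<Longrightarrow> 0 \<le> f s"
  shows "continuous_on S (\<lambda>s::'s::metric_space. collision_rate F (f s) (g s) (h s) (k s))"
  unfolding collision_rate_def
proof (rule continuous_on_integral_dominated)
  have R: "0 \<le> R" using admissible_nonneg[OF F] .
  show "\<bar>collision_density F (f s) (g s) (h s) (k s) \<omega>\<bar> \<le> (4 * R + 12 * R\<^sup>2) * R * (2 + 2 / \<beta>)"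
    if "s \<in> S" "\<omega> \<in> space sphere_measure" for s \<omega>
  proof -
    have "(2 + 2 / \<beta>) * exp (- (\<beta> / 2) * (norm (k s))\<^sup>2) \<le> 2 + 2 / \<beta>"
      using \<beta> by (intro mult_left_le) auto
    then have "(4 * R + 12 * R\<^sup>2) * R * ((2 + 2 / \<beta>) * exp (- (\<beta> / 2) * (norm (k s))\<^sup>2)) \<le> (4 * R + 12 * R\<^sup>2) * R * (2 + 2 / \<beta>)"
      using R by (intro mult_left_mono) auto
    with collision_density_bound'[OF F nonneg[OF that(1)] _ \<beta>] show ?thesis
      using that by (fastforce simp: space_sphere_measure intro: order_trans)
  qed
qed (auto intro!: collision_density_continuous_on[OF F] cont nonneg borel_measurable_collision_density[OF F])

lemma integrable_collision_rate:
  assumes "admissible \<beta> R F" "t \<ge> 0" "\<beta> > 0"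
  shows "integrable lborel (collision_rate F t x v)"
proof (rule Bochner_Integration.integrable_bound)
  show "integrable lborel (\<lambda>u::real^3. sphere_area * ((4 * R + 12 * R\<^sup>2) * R * ((2 + 2 / \<beta>) * exp (- (\<beta> / 2) * (norm u)\<^sup>2))))"
    by (intro integrable_mult_right integrable_gaussian_vec) (use assms(3) in simp)
  show "collision_rate F t x v \<in> borel_measurable lborel"
    unfolding measurable_lborel2
    by (intro borel_measurable_continuous_onI collision_rate_continuous_on[OF assms(1,3)] continuous_on_const continuous_on_id assms(2))
  show "AE u in lborel. norm (collision_rate F t x v u)
      \<le> norm (sphere_area * ((4 * R + 12 * R\<^sup>2) * R * ((2 + 2 / \<beta>) * exp (- (\<beta> / 2) * (norm u)\<^sup>2))))"
    by (intro AE_I2, unfold real_norm_def)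
      (rule order_trans[OF collision_rate_bound[OF assms] abs_ge_self])
qed

lemma Qcoll_eq_integral_collision_rate: "Qcoll (- 1) F t x v = (LINT u|lborel. collision_rate F t x v u)"
  by (simp add: Qcoll_fermion collision_rate_def)

lemma Qcoll_continuous_on:
  assumes F: "admissible \<beta> R F" and \<beta>: "\<beta> > 0"
    and cont: "continuous_on S f" "continuous_on S g" "continuous_on S h"
    and nonneg: "\<And>s. s \<in> S \<Longrightarrow> 0 \<le> f s"
  shows "continuous_on S (\<lambda>s::'s::metric_space. Qcoll (- 1) F (f s) (g s) (h s))"
  unfolding Qcoll_eq_integral_collision_rate
proof (rule continuous_on_integral_dominated)
  show "integrable lborel (\<lambda>u::real^3. sphere_area * ((4 * R + 12 * R\<^sup>2) * R * ((2 + 2 / \<beta>) * exp (- (\<beta> / 2) * (norm u)\<^sup>2))))"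
    by (intro integrable_mult_right integrable_gaussian_vec) (use \<beta> in simp)
  show "collision_rate F (f s) (g s) (h s) \<in> borel_measurable lborel" if "s \<in> S" for s
    using integrable_collision_rate[OF F nonneg[OF that] \<beta>] by auto
qed (intro collision_rate_continuous_on[OF F \<beta>] collision_rate_bound[OF F] cont nonneg \<beta> continuous_on_const; assumption)+

text \<open>This crude bound does not decay in time and only supplies the constant \<open>B\<close>
  of \<open>continuous_on_time_integral\<close>. Control of the time integral uniformly in
  \<open>t\<close> requires the dispersion estimate.\<close>

lemma Qcoll_bounded:
  assumes F: "admissible \<beta> R F" and \<beta>: "\<beta> > 0"
  obtains B where "\<And>t x v. t \<ge> 0 \<Longrightarrow> \<bar>Qcoll (- 1) F t x v\<bar> \<le> B"
proof
  fix t x v assume "(0::real) \<le> t"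
  then have "norm (Qcoll (- 1) F t x v) \<le>
      (LINT u|lborel. sphere_area * ((4 * R + 12 * R\<^sup>2) * R * ((2 + 2 / \<beta>) * exp (- (\<beta> / 2) * (norm (u::real^3))\<^sup>2))))"
    unfolding Qcoll_eq_integral_collision_rate real_norm_def
    by (intro Bochner_Integration.integral_abs_bound_integral integrable_collision_rate[OF F]
        integrable_mult_right integrable_gaussian_vec collision_rate_bound[OF F]) (use \<beta> in simp_all)
  then show "\<bar>Qcoll (- 1) F t x v\<bar> \<le>
      (LINT u|lborel. sphere_area * ((4 * R + 12 * R\<^sup>2) * R * ((2 + 2 / \<beta>) * exp (- (\<beta> / 2) * (norm (u::real^3))\<^sup>2))))"
    by simp
qed

section \<open>The dispersion estimate along characteristics\<close>

lemma weight_shifted: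
  "weight \<beta> t (x + t *\<^sub>R v) u = exp (- \<beta> * (norm (x + t *\<^sub>R (v - u)))\<^sup>2) * exp (- \<beta> * (norm u)\<^sup>2)"
  by (simp add: weight_def algebra_simps flip: exp_add)

lemma weight_shifted_self: "weight \<beta> t (x + t *\<^sub>R v) v = weight \<beta> 0 x v"
  by (simp add: weight_def)

text \<open>Along the characteristic of \<open>v\<close> the weight of \<open>v\<close> is constant,
  and the weight of \<open>u\<close> depends on time only through the relative motion x + t (v - u).
  Hence the first factor is free of \<open>t\<close> and the second is the integrand of
  \<open>nn_integral_gaussian_line\<close>. The extended nonnegative integral prepares the exchange
  of the time and velocity integrals.\<close>

lemma sharp_Qcoll_diff_bound:
  assumes F: "admissible \<beta> R F" and G: "admissible \<beta> R G"
    and D: "\<And>x v. \<bar>F t x v - G t x v\<bar> \<le> D * weight \<beta> t x v" and t: "t \<ge> 0" and \<beta>: "\<beta> > 0"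
  shows "ennreal \<bar>sharp (Qcoll (- 1) F) t x v - sharp (Qcoll (- 1) G) t x v\<bar>
    \<le> (\<integral>\<^sup>+u. ennreal (sphere_area * (4 * R + 12 * R\<^sup>2) * D * weight \<beta> 0 x v * exp (- \<beta> * (norm u)\<^sup>2)) *
         ennreal (norm (v - u) * exp (- \<beta> * (norm (x + t *\<^sub>R (v - u)))\<^sup>2)) \<partial>lborel)"
proof -
  have nonneg: "0 \<le> sphere_area * (4 * R + 12 * R\<^sup>2) * D * weight \<beta> 0 x v"
  proof -
    have "0 \<le> D * weight \<beta> t x v" using D[of x v] by linarith
    then have "0 \<le> D" using weight_pos[of \<beta> t x v] by (simp add: zero_le_mult_iff)
    then show ?thesis using admissible_nonneg[OF F] weight_pos[of \<beta> 0 x v] by simp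
  qed
  let ?F = "collision_rate F t (x + t *\<^sub>R v) v" and ?G = "collision_rate G t (x + t *\<^sub>R v) v"
  have int: "integrable lborel ?F" "integrable lborel ?G"
    by (rule integrable_collision_rate[OF F t \<beta>] integrable_collision_rate[OF G t \<beta>])+
  have "sharp (Qcoll (- 1) F) t x v - sharp (Qcoll (- 1) G) t x v = (LINT u|lborel. ?F u - ?G u)"
    unfolding sharp_def Qcoll_eq_integral_collision_rate
    by (rule Bochner_Integration.integral_diff[OF int, symmetric])
  then have "ennreal \<bar>sharp (Qcoll (- 1) F) t x v - sharp (Qcoll (- 1) G) t x v\<bar> \<le> (\<integral>\<^sup>+u. ennreal \<bar>?F u - ?G u\<bar> \<partial>lborel)"
    using integral_norm_bound_ennreal[OF Bochner_Integration.integrable_diff[OF int]] by simp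
  also have "\<dots> \<le> (\<integral>\<^sup>+u. ennreal (sphere_area * (4 * R + 12 * R\<^sup>2) * D * weight \<beta> 0 x v * exp (- \<beta> * (norm u)\<^sup>2)) *
         ennreal (norm (v - u) * exp (- \<beta> * (norm (x + t *\<^sub>R (v - u)))\<^sup>2)) \<partial>lborel)"
  proof (rule nn_integral_mono)
    fix u
    have "\<bar>?F u - ?G u\<bar> \<le> sphere_area * ((4 * R + 12 * R\<^sup>2) * D *
        (norm (v - u) * (weight \<beta> t (x + t *\<^sub>R v) u * weight \<beta> t (x + t *\<^sub>R v) v)))"
      by (rule collision_rate_diff_bound[OF F G D t \<beta>])
    also have "\<dots> = (sphere_area * (4 * R + 12 * R\<^sup>2) * D * weight \<beta> 0 x v * exp (- \<beta> * (norm u)\<^sup>2)) *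
         (norm (v - u) * exp (- \<beta> * (norm (x + t *\<^sub>R (v - u)))\<^sup>2))"
      unfolding weight_shifted_self weight_shifted by (simp only: mult_ac)
    finally show "ennreal \<bar>?F u - ?G u\<bar> \<le> ennreal (sphere_area * (4 * R + 12 * R\<^sup>2) * D * weight \<beta> 0 x v * exp (- \<beta> * (norm u)\<^sup>2)) *
         ennreal (norm (v - u) * exp (- \<beta> * (norm (x + t *\<^sub>R (v - u)))\<^sup>2))"
      using nonneg by (subst ennreal_mult[symmetric]) (auto intro: ennreal_leI)
  qed
  finally show ?thesis .
qed

lemma sharp_Qcoll_continuous_on:
  assumes F: "admissible \<beta> R F" and \<beta>: "\<beta> > 0"
    and cont: "continuous_on S f" "continuous_on S g" "continuous_on S h"
    and nonneg: "\<And>s. s \<in> S \<Longrightarrow> 0 \<le> f s"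
  shows "continuous_on S (\<lambda>s::'s::metric_space. sharp (Qcoll (- 1) F) (f s) (g s) (h s))"
  unfolding sharp_def by (intro Qcoll_continuous_on[OF F \<beta>] continuous_intros cont nonneg)

lemma set_integrable_sharp_Qcoll:
  assumes F: "admissible \<beta> R F" and \<beta>: "\<beta> > 0"
  shows "set_integrable lborel {0..t} (\<lambda>\<tau>. sharp (Qcoll (- 1) F) \<tau> x v)"
  by (intro borel_integrable_atLeastAtMost' sharp_Qcoll_continuous_on[OF F \<beta>] continuous_intros) simp

text \<open>Dispersion: integrated over time, the relative speed is absorbed by the motion along the
  line \<open>x + \<tau> (v - u)\<close>, which leaves four Gaussian factors \<open>sqrt (\<pi> / \<beta>)\<close>.\<close>
lemma time_integral_Qcoll_diff_bound:
  assumes F: "admissible \<beta> R F" and G: "admissible \<beta> R G"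
    and D: "\<And>t x v. t \<ge> 0 \<Longrightarrow> \<bar>F t x v - G t x v\<bar> \<le> D * weight \<beta> t x v" and \<beta>: "\<beta> > 0"
  shows "\<bar>(LINT \<tau>:{0..t}|lborel. sharp (Qcoll (- 1) F) \<tau> x v) - (LINT \<tau>:{0..t}|lborel. sharp (Qcoll (- 1) G) \<tau> x v)\<bar>
    \<le> sphere_area * pi\<^sup>2 * (4 * R + 12 * R\<^sup>2) / \<beta>\<^sup>2 * D * weight \<beta> 0 x v"
proof -
  define K where "K = sphere_area * (4 * R + 12 * R\<^sup>2) * D * weight \<beta> 0 x v"
  have K: "0 \<le> K"
  proof -
    have "0 \<le> D * weight \<beta> 0 x v" using D[of 0 x v] by linarith
    then show ?thesis using admissible_nonneg[OF F] by (simp add: K_def mult.assoc)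
  qed
  let ?q = "\<lambda>F \<tau>. sharp (Qcoll (- 1) F) \<tau> x v"
  have int: "set_integrable lborel {0..t} (?q F)" "set_integrable lborel {0..t} (?q G)"
    by (rule set_integrable_sharp_Qcoll[OF F \<beta>] set_integrable_sharp_Qcoll[OF G \<beta>])+
  have int': "integrable lborel (\<lambda>\<tau>. indicator {0..t} \<tau> *\<^sub>R (?q F \<tau> - ?q G \<tau>))"
    using set_integral_diff(1)[OF int] by (simp add: set_integrable_def)
  have "ennreal \<bar>(LINT \<tau>:{0..t}|lborel. ?q F \<tau>) - (LINT \<tau>:{0..t}|lborel. ?q G \<tau>)\<bar>
      = norm (LINT \<tau>|lborel. indicator {0..t} \<tau> *\<^sub>R (?q F \<tau> - ?q G \<tau>))"
    using set_integral_diff(2)[OF int] by (simp add: set_lebesgue_integral_def)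
  also have "\<dots> \<le> (\<integral>\<^sup>+\<tau>. norm (indicator {0..t} \<tau> *\<^sub>R (?q F \<tau> - ?q G \<tau>)) \<partial>lborel)"
    by (rule Bochner_Integration.integral_norm_bound_ennreal[OF int'])
  \<comment> \<open>Dropping the indicator extends the time integral to the whole line, which makes
    the final bound independent of \<open>t\<close>.\<close>
  also have "\<dots> \<le> (\<integral>\<^sup>+\<tau>. (\<integral>\<^sup>+u. ennreal (K * exp (- \<beta> * (norm u)\<^sup>2)) *
         ennreal (norm (v - u) * exp (- \<beta> * (norm (x + \<tau> *\<^sub>R (v - u)))\<^sup>2)) \<partial>lborel) \<partial>lborel)"
    using sharp_Qcoll_diff_bound[OF F G D _ \<beta>, where x=x and v=v]
    by (intro nn_integral_mono) (auto simp: K_def split: split_indicator)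
  also have "\<dots> = (\<integral>\<^sup>+u. (\<integral>\<^sup>+\<tau>. ennreal (K * exp (- \<beta> * (norm u)\<^sup>2)) *
         ennreal (norm (v - u) * exp (- \<beta> * (norm (x + \<tau> *\<^sub>R (v - u)))\<^sup>2)) \<partial>lborel) \<partial>lborel)"
    by (rule lborel_pair.Fubini') measurable
  also have "\<dots> = (\<integral>\<^sup>+u. ennreal (K * exp (- \<beta> * (norm u)\<^sup>2)) *
         (\<integral>\<^sup>+\<tau>. ennreal (norm (v - u) * exp (- \<beta> * (norm (x + \<tau> *\<^sub>R (v - u)))\<^sup>2)) \<partial>lborel) \<partial>lborel)"
    by (intro nn_integral_cong nn_integral_cmult) measurable
  also have "\<dots> \<le> (\<integral>\<^sup>+u. ennreal (K * exp (- \<beta> * (norm u)\<^sup>2)) * ennreal (sqrt (pi / \<beta>)) \<partial>(lborel :: (real^3) measure))"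
    by (intro nn_integral_mono mult_left_mono nn_integral_gaussian_line \<beta>) simp
  also have "\<dots> = (\<integral>\<^sup>+u. ennreal (K * sqrt (pi / \<beta>)) * ennreal (exp (- \<beta> * (norm u)\<^sup>2)) \<partial>(lborel :: (real^3) measure))"
    using K \<beta> by (intro nn_integral_cong) (simp add: mult_ac flip: ennreal_mult)
  also have "\<dots> = ennreal (K * sqrt (pi / \<beta>)) * ennreal (sqrt (pi / \<beta>) ^ 3)"
    unfolding nn_integral_gaussian_vec[OF \<beta>, symmetric] by (rule nn_integral_cmult) measurable
  also have "\<dots> = ennreal (K * (pi / \<beta>)\<^sup>2)"
  proof -
    have "sqrt (pi / \<beta>) * sqrt (pi / \<beta>) ^ 3 = ((sqrt (pi / \<beta>))\<^sup>2)\<^sup>2"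
      by (simp only: power2_eq_square power3_eq_cube mult.assoc)
    then have "sqrt (pi / \<beta>) * sqrt (pi / \<beta>) ^ 3 = (pi / \<beta>)\<^sup>2"
      using \<beta> by simp
    then have "K * sqrt (pi / \<beta>) * sqrt (pi / \<beta>) ^ 3 = K * (pi / \<beta>)\<^sup>2" by (simp add: mult.assoc)
    then show ?thesis using K \<beta> by (simp flip: ennreal_mult)
  qed
  finally have "\<bar>(LINT \<tau>:{0..t}|lborel. ?q F \<tau>) - (LINT \<tau>:{0..t}|lborel. ?q G \<tau>)\<bar> \<le> K * (pi / \<beta>)\<^sup>2"
    using K by (simp add: ennreal_le_iff)
  then show ?thesis by (simp add: K_def power_divide mult_ac)
qed

section \<open>The contraction\<close>

text \<open>A profile stands for \<open>sharp F\<close> divided by the Gaussian. Its supremum norm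
  is then the weighted norm, and the space is complete.\<close>

type_synonym profile = "(real \<times> (real^3) \<times> (real^3)) \<Rightarrow>\<^sub>C real"

text \<open>The positive part is built in here: the collision term sees only the truncated function,
  while \<open>h\<close> itself may take negative values.\<close>

definition profile_fun :: "real \<Rightarrow> profile \<Rightarrow> phase_fun" where
  "profile_fun \<beta> h t x v = max 0 (weight \<beta> t x v * apply_bcontfun h (t, x - t *\<^sub>R v, v))"

lemma admissible_profile_fun:
  assumes "norm h \<le> R"
  shows "admissible \<beta> R (profile_fun \<beta> h)"
  unfolding admissible_def
proof (intro conjI allI impI)
  have "continuous_on UNIV (\<lambda>z. apply_bcontfun h (fst z, fst (snd z) - fst z *\<^sub>R snd (snd z), snd (snd z)))"
    by (rule continuous_on_compose2[OF continuous_on_apply_bcontfun[of UNIV h]]) (auto intro!: continuous_intros)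
  then have "continuous_on UNIV (\<lambda>(t, x, v). profile_fun \<beta> h t x v)"
    unfolding profile_fun_def weight_def case_prod_unfold by (intro continuous_intros)
  then show "continuous_on ({0..} \<times> UNIV \<times> UNIV) (\<lambda>(t, x, v). profile_fun \<beta> h t x v)"
    by (rule continuous_on_subset) simp
  fix t x v
  have "\<bar>apply_bcontfun h (t, x - t *\<^sub>R v, v)\<bar> \<le> R"
    using norm_bounded[of h "(t, x - t *\<^sub>R v, v)"] assms by simp
  then have "\<bar>weight \<beta> t x v * apply_bcontfun h (t, x - t *\<^sub>R v, v)\<bar> \<le> R * weight \<beta> t x v"
    using weight_pos[of \<beta> t x v] by (simp add: abs_mult mult.commute)
  then show "\<bar>profile_fun \<beta> h t x v\<bar> \<le> R * weight \<beta> t x v"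
    unfolding profile_fun_def by linarith
qed

text \<open>Taking the positive part is 1-Lipschitz, so the truncation does not worsen the
  contraction constant.\<close>

lemma profile_fun_diff_bound:
  "\<bar>profile_fun \<beta> h t x v - profile_fun \<beta> k t x v\<bar> \<le> dist h k * weight \<beta> t x v"
proof -
  let ?z = "(t, x - t *\<^sub>R v, v)"
  have "\<bar>apply_bcontfun h ?z - apply_bcontfun k ?z\<bar> \<le> dist h k"
    using dist_bounded[of h ?z k] by (simp add: dist_real_def)
  then have "\<bar>weight \<beta> t x v * apply_bcontfun h ?z - weight \<beta> t x v * apply_bcontfun k ?z\<bar> \<le> dist h k * weight \<beta> t x v"
    using weight_pos[of \<beta> t x v] by (simp add: abs_mult mult.commute flip: right_diff_distrib)
  then show ?thesis unfolding profile_fun_def by linarith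
qed

lemma sharp_profile_fun: "sharp (profile_fun \<beta> h) t x v = max 0 (weight \<beta> 0 x v * apply_bcontfun h (t, x, v))"
  by (simp add: sharp_def profile_fun_def weight_shifted_self)

text \<open>The Lipschitz constant, in the weighted norm on the ball of radius \<open>R\<close>, of
  the time-integrated collision term.\<close>

definition collision_constant :: "real \<Rightarrow> real \<Rightarrow> real" where
  "collision_constant \<beta> R = sphere_area * pi\<^sup>2 * (4 * R + 12 * R\<^sup>2) / \<beta>\<^sup>2"

lemma time_integral_Qcoll_bound:
  assumes F: "admissible \<beta> R F" and \<beta>: "\<beta> > 0"
  shows "\<bar>LINT \<tau>:{0..t}|lborel. sharp (Qcoll (- 1) F) \<tau> x v\<bar> \<le> collision_constant \<beta> R * R * weight \<beta> 0 x v"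
proof -
  have "\<bar>F t x v - 0\<bar> \<le> R * weight \<beta> t x v" if "t \<ge> 0" for t x v
    using F that by (simp add: admissible_def)
  from time_integral_Qcoll_diff_bound[OF F admissible_zero[OF admissible_nonneg[OF F]] this \<beta>, of t x v]
  show ?thesis
    by (simp add: sharp_def Qcoll_eq_integral_collision_rate collision_rate_def collision_density_def collision_constant_def)
qed

lemma time_integral_Qcoll_continuous:
  assumes F: "admissible \<beta> R F" and \<beta>: "\<beta> > 0"
  shows "continuous_on UNIV (\<lambda>(t, x, v). LINT \<tau>:{0..max t 0}|lborel. sharp (Qcoll (- 1) F) \<tau> x v)"
proof -
  obtain B where B: "\<And>t x v. t \<ge> 0 \<Longrightarrow> \<bar>Qcoll (- 1) F t x v\<bar> \<le> B"
    using Qcoll_bounded[OF F \<beta>] by blast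
  have "continuous_on UNIV (\<lambda>(t, p). LINT \<tau>:{0..max t 0}|lborel. sharp (Qcoll (- 1) F) \<tau> (fst p) (snd p))"
  proof (rule continuous_on_time_integral)
    show "continuous_on ({0..} \<times> UNIV) (\<lambda>(\<tau>, p). sharp (Qcoll (- 1) F) \<tau> (fst p) (snd p))"
      unfolding case_prod_unfold by (intro sharp_Qcoll_continuous_on[OF F \<beta>] continuous_intros) auto
    show "\<bar>sharp (Qcoll (- 1) F) \<tau> (fst p) (snd p)\<bar> \<le> B" if "\<tau> \<ge> 0" for \<tau> p
      using B[OF that] by (simp add: sharp_def)
  qed
  then show ?thesis by (simp add: case_prod_unfold)
qed

text \<open>The right-hand side of the integral equation, divided by the Gaussian. For negative
  times it is frozen at its value at time 0, because a profile is defined at all real times.\<close>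

definition picard :: "real \<Rightarrow> (real^3 \<Rightarrow> real^3 \<Rightarrow> real) \<Rightarrow> profile \<Rightarrow> profile" where
  "picard \<beta> F0 h = Bcontfun (\<lambda>(t, x, v).
     (F0 x v + (LINT \<tau>:{0..max t 0}|lborel. sharp (Qcoll (- 1) (profile_fun \<beta> h)) \<tau> x v)) / weight \<beta> 0 x v)"

text \<open>\<open>Bcontfun\<close> can be evaluated as expected only at bounded continuous
  functions. Continuity comes from that of the time integral, boundedness from the datum bound and
  the dispersion estimate.\<close>

lemma picard_apply:
  assumes \<beta>: "\<beta> > 0" and cont: "continuous_on UNIV (\<lambda>(x, v). F0 x v)"
    and F0: "\<And>x v. \<bar>F0 x v\<bar> \<le> \<delta> * weight \<beta> 0 x v"
  shows "apply_bcontfun (picard \<beta> F0 h) (t, x, v) =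
    (F0 x v + (LINT \<tau>:{0..max t 0}|lborel. sharp (Qcoll (- 1) (profile_fun \<beta> h)) \<tau> x v)) / weight \<beta> 0 x v"
proof -
  let ?g = "\<lambda>(t, x, v). (F0 x v + (LINT \<tau>:{0..max t 0}|lborel. sharp (Qcoll (- 1) (profile_fun \<beta> h)) \<tau> x v)) / weight \<beta> 0 x v"
  have adm: "admissible \<beta> (norm h) (profile_fun \<beta> h)" by (rule admissible_profile_fun) simp
  have "?g \<in> bcontfun"
  proof (rule bcontfun_normI)
    have "continuous_on UNIV (\<lambda>z::real \<times> (real^3) \<times> (real^3). F0 (fst (snd z)) (snd (snd z)))"
      using continuous_on_compose2[OF cont, of UNIV snd] by (simp add: case_prod_unfold continuous_on_snd)
    moreover have "continuous_on UNIV (\<lambda>z. weight \<beta> 0 (fst (snd z)) (snd (snd z)))"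
      unfolding weight_def by (intro continuous_intros)
    ultimately show "continuous_on UNIV ?g"
      using time_integral_Qcoll_continuous[OF adm \<beta>] less_imp_neq[OF weight_pos]
      unfolding case_prod_unfold by (intro continuous_intros) auto
    fix z :: "real \<times> (real^3) \<times> (real^3)"
    obtain t x v where z: "z = (t, x, v)" by (cases z)
    have "\<bar>F0 x v + (LINT \<tau>:{0..max t 0}|lborel. sharp (Qcoll (- 1) (profile_fun \<beta> h)) \<tau> x v)\<bar>
        \<le> \<delta> * weight \<beta> 0 x v + collision_constant \<beta> (norm h) * norm h * weight \<beta> 0 x v"
      by (rule order_trans[OF abs_triangle_ineq add_mono[OF F0 time_integral_Qcoll_bound[OF adm \<beta>]]])
    then show "norm (?g z) \<le> \<delta> + collision_constant \<beta> (norm h) * norm h"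
      using weight_pos[of \<beta> 0 x v] by (simp add: z divide_le_eq distrib_right)
  qed
  then show ?thesis by (simp add: picard_def Bcontfun_inverse)
qed

text \<open>The datum takes one half of the radius and the collision term at most the other half, so
  the ball is mapped into itself; the same smallness gives contraction factor 1/2. In the resulting
  equation the left-hand side is not truncated, and its sign is still open.\<close>

lemma ex_truncated_solution:
  assumes \<beta>: "\<beta> > 0" and r: "r > 0" and small: "collision_constant \<beta> r \<le> 1 / 2"
    and cont: "continuous_on UNIV (\<lambda>(x, v). F0 x v)" and F0: "\<And>x v. \<bar>F0 x v\<bar> \<le> r / 2 * weight \<beta> 0 x v"
  obtains h where "norm h \<le> r"
    "\<And>t x v. t \<ge> 0 \<Longrightarrow> weight \<beta> 0 x v * apply_bcontfun h (t, x, v) =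
       F0 x v + (LINT \<tau>:{0..t}|lborel. sharp (Qcoll (- 1) (profile_fun \<beta> h)) \<tau> x v)"
proof -
  note app = picard_apply[OF \<beta> cont F0]
  have self_map: "picard \<beta> F0 h \<in> cball 0 r" if "h \<in> cball 0 r" for h
  proof -
    have adm: "admissible \<beta> r (profile_fun \<beta> h)" using that by (intro admissible_profile_fun) simp
    have "norm (apply_bcontfun (picard \<beta> F0 h) z) \<le> r" for z
    proof -
      obtain t x v where z: "z = (t, x, v)" by (cases z)
      have "\<bar>F0 x v + (LINT \<tau>:{0..max t 0}|lborel. sharp (Qcoll (- 1) (profile_fun \<beta> h)) \<tau> x v)\<bar>
          \<le> r / 2 * weight \<beta> 0 x v + collision_constant \<beta> r * r * weight \<beta> 0 x v"
        by (rule order_trans[OF abs_triangle_ineq add_mono[OF F0 time_integral_Qcoll_bound[OF adm \<beta>]]])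
      also have "\<dots> \<le> r / 2 * weight \<beta> 0 x v + 1 / 2 * r * weight \<beta> 0 x v"
        using small r weight_pos[of \<beta> 0 x v] by (intro add_mono mult_right_mono) auto
      also have "\<dots> = r * weight \<beta> 0 x v" by simp
      finally show ?thesis using weight_pos[of \<beta> 0 x v] by (simp add: z app divide_le_eq)
    qed
    then show ?thesis by (simp add: norm_bound)
  qed
  have contraction: "dist (picard \<beta> F0 h) (picard \<beta> F0 k) \<le> 1 / 2 * dist h k" if "h \<in> cball 0 r" "k \<in> cball 0 r" for h k
  proof (rule dist_bound)
    fix z :: "real \<times> (real^3) \<times> (real^3)"
    obtain t x v where z: "z = (t, x, v)" by (cases z)
    have adm: "admissible \<beta> r (profile_fun \<beta> h)" "admissible \<beta> r (profile_fun \<beta> k)"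
      using that by (auto intro!: admissible_profile_fun)
    let ?I = "\<lambda>h. LINT \<tau>:{0..max t 0}|lborel. sharp (Qcoll (- 1) (profile_fun \<beta> h)) \<tau> x v"
    have "\<bar>?I h - ?I k\<bar> \<le> collision_constant \<beta> r * dist h k * weight \<beta> 0 x v"
      using time_integral_Qcoll_diff_bound[OF adm profile_fun_diff_bound \<beta>] by (simp add: collision_constant_def)
    also have "\<dots> \<le> 1 / 2 * dist h k * weight \<beta> 0 x v"
      using small weight_pos[of \<beta> 0 x v] by (intro mult_right_mono) auto
    finally have "\<bar>?I h - ?I k\<bar> / weight \<beta> 0 x v \<le> 1 / 2 * dist h k"
      using weight_pos[of \<beta> 0 x v] by (simp add: divide_le_eq)
    moreover have "apply_bcontfun (picard \<beta> F0 h) z - apply_bcontfun (picard \<beta> F0 k) z = (?I h - ?I k) / weight \<beta> 0 x v"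
      unfolding z app by (simp flip: diff_divide_distrib)
    ultimately show "dist (apply_bcontfun (picard \<beta> F0 h) z) (apply_bcontfun (picard \<beta> F0 k) z) \<le> 1 / 2 * dist h k"
      using weight_pos[of \<beta> 0 x v] by (simp add: dist_real_def)
  qed
  have "\<exists>!h\<in>cball 0 r. picard \<beta> F0 h = h"
    using r self_map contraction by (intro Banach_fix[of _ "1/2"]) (auto simp: complete_eq_closed)
  then obtain h where h: "h \<in> cball 0 r" "picard \<beta> F0 h = h" by blast
  show thesis
  proof
    show "norm h \<le> r" using h by simp
    show "weight \<beta> 0 x v * apply_bcontfun h (t, x, v) = F0 x v + (LINT \<tau>:{0..t}|lborel. sharp (Qcoll (- 1) (profile_fun \<beta> h)) \<tau> x v)"
      if "t \<ge> 0" for t x v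
      using app[of h t x v] that weight_pos[of \<beta> 0 x v] h(2) by (simp add: field_simps)
  qed
qed

section \<open>The weighted norms\<close>

lemma exp_mult_le_iff: "exp p * a \<le> R \<longleftrightarrow> a \<le> R * exp (- p)" for a p R :: real
  using pos_le_divide_eq[of "exp p" a R] by (simp add: exp_minus divide_inverse mult.commute)

text \<open>The bound by \<open>c\<close> makes the set of values bounded above; only then does the
  supremum dominate each value.\<close>

lemma weighted_SUP_bound:
  fixes f :: "'a \<Rightarrow> real"
  assumes "z \<in> A" and c: "\<And>z. z \<in> A \<Longrightarrow> \<bar>f z\<bar> \<le> c * exp (- p z)" and "(SUP z\<in>A. exp (p z) * \<bar>f z\<bar>) \<le> R"
  shows "\<bar>f z\<bar> \<le> R * exp (- p z)"
proof -
  have "exp (p z) * \<bar>f z\<bar> \<le> (SUP z\<in>A. exp (p z) * \<bar>f z\<bar>)"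
  proof (rule cSUP_upper[OF assms(1)], rule bdd_aboveI2)
    fix z assume "z \<in> A"
    from c[OF this] show "exp (p z) * \<bar>f z\<bar> \<le> c" by (simp only: exp_mult_le_iff)
  qed
  also note assms(3)
  finally show ?thesis by (simp only: exp_mult_le_iff)
qed

lemma S_ball_bound:
  assumes "F \<in> S_ball \<beta> R" "t \<ge> 0"
  shows "\<bar>F t x v\<bar> \<le> R * weight \<beta> 0 x v"
proof -
  let ?p = "\<lambda>(t::real, x::real^3, v::real^3). \<beta> * ((norm x)\<^sup>2 + (norm v)\<^sup>2)" and ?f = "\<lambda>(t, x, v). F t x v"
  obtain c where c: "\<And>t x v. t \<ge> 0 \<Longrightarrow> \<bar>F t x v\<bar> \<le> c * exp (- \<beta> * ((norm x)\<^sup>2 + (norm v)\<^sup>2))"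
    using assms(1) by (auto simp: S_ball_def S_space_def)
  have "(SUP z\<in>{0..} \<times> UNIV \<times> UNIV. exp (?p z) * \<bar>?f z\<bar>) \<le> R"
    using assms(1) by (simp add: S_ball_def S_norm_def case_prod_unfold)
  then have "\<bar>?f (t, x, v)\<bar> \<le> R * exp (- ?p (t, x, v))"
    by (rule weighted_SUP_bound[where f="?f" and p="?p" and A="{0..} \<times> UNIV \<times> UNIV" and c=c, rotated 2])
      (use assms(2) c in auto)
  then show ?thesis by (simp add: weight_def)
qed

lemma S_ballI:
  assumes "continuous_on ({0..} \<times> UNIV \<times> UNIV) (\<lambda>(t, x, v). F t x v)" "R > 0"
    and bound: "\<And>t x v. t \<ge> 0 \<Longrightarrow> \<bar>F t x v\<bar> \<le> R * weight \<beta> 0 x v"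
  shows "F \<in> S_ball \<beta> R"
proof -
  have "F \<in> S_space \<beta>"
    using assms by (auto simp: S_space_def weight_def intro!: exI[of _ R])
  moreover have "S_norm \<beta> F \<le> R"
    unfolding S_norm_def
  proof (rule cSUP_least)
    fix z :: "real \<times> (real^3) \<times> (real^3)" assume z: "z \<in> {0..} \<times> UNIV \<times> UNIV"
    obtain t x v where txv: "z = (t, x, v)" by (cases z)
    have "\<bar>F t x v\<bar> \<le> R * exp (- (\<beta> * ((norm x)\<^sup>2 + (norm v)\<^sup>2)))"
      using bound[of t x v] z by (simp add: txv weight_def)
    then show "(case z of (t, x, v) \<Rightarrow> exp (\<beta> * ((norm x)\<^sup>2 + (norm v)\<^sup>2)) * \<bar>F t x v\<bar>) \<le> R"
      unfolding txv by (simp only: prod.case exp_mult_le_iff)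
  qed auto
  ultimately show ?thesis by (simp add: S_ball_def)
qed

lemma datum_bound:
  assumes "F0 \<in> datum_space \<beta>" "datum_norm \<beta> F0 \<le> \<delta>"
  shows "\<bar>F0 x v\<bar> \<le> \<delta> * weight \<beta> 0 x v"
proof -
  let ?p = "\<lambda>(x::real^3, v::real^3). \<beta> * ((norm x)\<^sup>2 + (norm v)\<^sup>2)" and ?f = "\<lambda>(x, v). F0 x v"
  obtain c where c: "\<And>x v. \<bar>F0 x v\<bar> \<le> c * exp (- \<beta> * ((norm x)\<^sup>2 + (norm v)\<^sup>2))"
    using assms(1) by (auto simp: datum_space_def)
  have "(SUP z\<in>UNIV. exp (?p z) * \<bar>?f z\<bar>) \<le> \<delta>"
    using assms(2) by (simp add: datum_norm_def case_prod_unfold)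
  then have "\<bar>?f (x, v)\<bar> \<le> \<delta> * exp (- ?p (x, v))"
    by (rule weighted_SUP_bound[where f="?f" and p="?p" and A=UNIV and c=c, rotated 2]) (use c in auto)
  then show ?thesis by (simp add: weight_def)
qed

lemma unsharp: "F t x v = sharp F t (x - t *\<^sub>R v) v"
  by (simp add: sharp_def)

lemma weight_unsharp: "weight \<beta> 0 (x - t *\<^sub>R v) v = weight \<beta> t x v"
  by (simp add: weight_def)

text \<open>\<open>F\<close> is \<open>sharp F\<close> composed with the continuous map that sends
  (t, x, v) to (t, x - t v, v). This map turns the Gaussian at time 0 into
  \<open>weight \<beta> t x v\<close>.\<close>

lemma admissible_if_sharp_S_ball:
  assumes "sharp F \<in> S_ball \<beta> R"
  shows "admissible \<beta> R F"
  unfolding admissible_def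
proof (intro conjI allI impI)
  have "continuous_on ({0..} \<times> UNIV \<times> UNIV) (\<lambda>(t, x, v). sharp F t x v)"
    using assms by (simp add: S_ball_def S_space_def)
  moreover have "continuous_on ({0..} \<times> UNIV \<times> UNIV) (\<lambda>z::real \<times> (real^3) \<times> (real^3). (fst z, fst (snd z) - fst z *\<^sub>R snd (snd z), snd (snd z)))"
    by (intro continuous_intros)
  moreover have "(\<lambda>z::real \<times> (real^3) \<times> (real^3). (fst z, fst (snd z) - fst z *\<^sub>R snd (snd z), snd (snd z))) ` ({0..} \<times> UNIV \<times> UNIV)
      \<subseteq> {0..} \<times> UNIV \<times> UNIV" by auto
  ultimately have "continuous_on ({0..} \<times> UNIV \<times> UNIV) (\<lambda>z::real \<times> (real^3) \<times> (real^3).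
      sharp F (fst z) (fst (snd z) - fst z *\<^sub>R snd (snd z)) (snd (snd z)))"
    by (auto dest: continuous_on_compose2)
  then show "continuous_on ({0..} \<times> UNIV \<times> UNIV) (\<lambda>(t, x, v). F t x v)"
    by (simp add: case_prod_unfold sharp_def)
  show "\<bar>F t x v\<bar> \<le> R * weight \<beta> t x v" if "t \<ge> 0" for t x v
    using S_ball_bound[OF assms that, of "x - t *\<^sub>R v" v] by (simp add: weight_unsharp flip: unsharp)
qed

section \<open>Positivity, existence and uniqueness\<close>

text \<open>The loss term has the factor \<open>F t x v\<close> and vanishes. What remains is the
  gain, whose exclusion factor \<open>1 - F t x u\<close> is nonnegative because \<open>F\<close> is
  at most 1.\<close>

lemma Qcoll_nonneg_at_zero:
  assumes F: "\<And>u. 0 \<le> F t x u" "\<And>u. F t x u \<le> 1" and v: "F t x v = 0"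
  shows "0 \<le> Qcoll (- 1) F t x v"
  unfolding Qcoll_fermion collision_density_def using assms
  by (intro Bochner_Integration.integral_nonneg) simp

text \<open>For fixed \<open>x\<close> and \<open>v\<close> this is the sign argument of
  \<open>nonneg_if_increasing_below_zero\<close> along the characteristic. Where the profile is
  negative the truncated function is zero, so its collision term is nonnegative.\<close>

lemma truncated_solution_nonneg:
  assumes \<beta>: "\<beta> > 0" and r: "r \<le> 1" "norm h \<le> r" and F0: "0 \<le> F0 x v" and t: "t \<ge> 0"
    and h: "\<And>t. t \<ge> 0 \<Longrightarrow> weight \<beta> 0 x v * apply_bcontfun h (t, x, v) =
       F0 x v + (LINT \<tau>:{0..t}|lborel. sharp (Qcoll (- 1) (profile_fun \<beta> h)) \<tau> x v)"
  shows "0 \<le> weight \<beta> 0 x v * apply_bcontfun h (t, x, v)"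
proof (rule nonneg_if_increasing_below_zero[OF _ h _ F0 _ t])
  have adm: "admissible \<beta> r (profile_fun \<beta> h)" using r by (intro admissible_profile_fun)
  show "set_integrable lborel {0..t} (\<lambda>\<tau>. sharp (Qcoll (- 1) (profile_fun \<beta> h)) \<tau> x v)" for t
    by (rule set_integrable_sharp_Qcoll[OF adm \<beta>])
  have "continuous_on {0..} (\<lambda>t. apply_bcontfun h (t, x, v))"
    by (rule continuous_on_compose2[OF continuous_on_apply_bcontfun[of UNIV h]]) (auto intro!: continuous_intros)
  then show "continuous_on {0..} (\<lambda>t. weight \<beta> 0 x v * apply_bcontfun h (t, x, v))"
    by (intro continuous_intros)
  fix \<tau> assume \<tau>: "\<tau> \<ge> 0" "weight \<beta> 0 x v * apply_bcontfun h (\<tau>, x, v) < 0"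
  \<comment> \<open>Here the radius at most 1 is used, together with the bound 1 on the
    weight.\<close>
  have le_1: "profile_fun \<beta> h \<tau> y u \<le> 1" for y u
  proof -
    have "\<bar>profile_fun \<beta> h \<tau> y u\<bar> \<le> r * weight \<beta> \<tau> y u"
      using adm \<tau> by (simp add: admissible_def)
    also have "\<dots> \<le> 1 * 1"
      using r weight_le_1[OF \<beta>] less_imp_le[OF weight_pos] by (intro mult_mono) auto
    finally show ?thesis by simp
  qed
  have "profile_fun \<beta> h \<tau> (x + \<tau> *\<^sub>R v) v = 0"
    using \<tau> by (simp add: profile_fun_def weight_shifted_self)
  then show "0 \<le> sharp (Qcoll (- 1) (profile_fun \<beta> h)) \<tau> x v"
    unfolding sharp_def by (intro Qcoll_nonneg_at_zero le_1) (auto simp: profile_fun_def)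
qed

text \<open>Once the truncated solution is known to be nonnegative, the positive part changes
  nothing and the truncated equation is the original one.\<close>

lemma ex_fermion_solution:
  assumes \<beta>: "\<beta> > 0" and r: "0 < r" "r \<le> 1" and small: "collision_constant \<beta> r \<le> 1 / 2"
    and F0: "F0 \<in> datum_space \<beta>" "\<And>x v. 0 \<le> F0 x v" "datum_norm \<beta> F0 \<le> r / 2"
  obtains F where "fermion_solution \<beta> r F0 F"
proof -
  have "continuous_on UNIV (\<lambda>(x, v). F0 x v)" using F0(1) by (simp add: datum_space_def)
  from ex_truncated_solution[OF \<beta> r(1) small this datum_bound[OF F0(1,3)]]
  obtain h where h: "norm h \<le> r" "\<And>t x v. t \<ge> 0 \<Longrightarrow> weight \<beta> 0 x v * apply_bcontfun h (t, x, v) =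
       F0 x v + (LINT \<tau>:{0..t}|lborel. sharp (Qcoll (- 1) (profile_fun \<beta> h)) \<tau> x v)"
    by blast
  define F where "F = profile_fun \<beta> h"
  have adm: "admissible \<beta> r F" unfolding F_def by (rule admissible_profile_fun[OF h(1)])
  have sharp_F: "sharp F t x v = weight \<beta> 0 x v * apply_bcontfun h (t, x, v)" if "t \<ge> 0" for t x v
  proof -
    have "0 \<le> weight \<beta> 0 x v * apply_bcontfun h (t, x, v)"
      by (rule truncated_solution_nonneg[OF \<beta> r(2) h(1) F0(2) that]) (rule h(2))
    then show ?thesis by (simp add: F_def sharp_profile_fun)
  qed
  have "sharp F \<in> S_ball \<beta> r"
  proof (rule S_ballI[OF _ r(1)])
    show "continuous_on ({0..} \<times> UNIV \<times> UNIV) (\<lambda>(t, x, v). sharp F t x v)"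
      unfolding sharp_def case_prod_unfold
      by (intro admissible_continuous_on[OF adm] continuous_intros) auto
    show "\<bar>sharp F t x v\<bar> \<le> r * weight \<beta> 0 x v" if "t \<ge> 0" for t x v
      using adm that unfolding sharp_def admissible_def by (metis weight_shifted_self)
  qed
  moreover have "sharp F t x v = F0 x v + (LINT \<tau>:{0..t}|lborel. sharp (Qcoll (- 1) F) \<tau> x v)" if "t \<ge> 0" for t x v
    using h(2)[OF that] sharp_F[OF that] by (simp add: F_def)
  moreover have "0 \<le> F t x v" for t x v by (simp add: F_def profile_fun_def)
  ultimately have "fermion_solution \<beta> r F0 F"
    by (simp add: fermion_solution_def mild_solution_def S_ball_def)
  then show thesis by (rule that)
qed

lemma fermion_solution_mono:
  "fermion_solution \<beta> r F0 F \<Longrightarrow> r \<le> R \<Longrightarrow> fermion_solution \<beta> R F0 F"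
  by (auto simp: fermion_solution_def S_ball_def)

text \<open>Subtracting the two integral equations removes the datum. Each use of the dispersion
  estimate then halves the constant in the weighted bound of the difference, starting from
  \<open>2 * R\<close> by the triangle inequality, and the limit is zero. The radius may exceed 1
  here.\<close>

lemma fermion_solution_unique:
  assumes \<beta>: "\<beta> > 0" and small: "collision_constant \<beta> R \<le> 1 / 2"
    and F: "fermion_solution \<beta> R F0 F" and G: "fermion_solution \<beta> R F0 G" and t: "t \<ge> 0"
  shows "G t x v = F t x v"
proof -
  have adm: "admissible \<beta> R F" "admissible \<beta> R G"
    using F G by (auto simp: fermion_solution_def intro: admissible_if_sharp_S_ball)
  have R: "0 \<le> R" by (rule admissible_nonneg[OF adm(1)])
  have diff: "\<bar>F t x v - G t x v\<bar> \<le> 2 * R * (1 / 2) ^ n * weight \<beta> t x v" if "t \<ge> 0" for n t x v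
    using that
  proof (induction n arbitrary: t x v)
    case 0
    then have "\<bar>F t x v\<bar> \<le> R * weight \<beta> t x v" "\<bar>G t x v\<bar> \<le> R * weight \<beta> t x v"
      using adm by (simp_all add: admissible_def)
    then show ?case by simp
  next
    case (Suc n)
    let ?y = "x - t *\<^sub>R v" and ?I = "\<lambda>F y. LINT \<tau>:{0..t}|lborel. sharp (Qcoll (- 1) F) \<tau> y v"
    have "H t x v = F0 ?y v + ?I H ?y" if "fermion_solution \<beta> R F0 H" for H
      using that Suc.prems by (subst unsharp[of H t x v]) (simp add: fermion_solution_def mild_solution_def)
    from this[OF F] this[OF G] have "F t x v - G t x v = ?I F ?y - ?I G ?y" by simp
    then have "\<bar>F t x v - G t x v\<bar> \<le> collision_constant \<beta> R * (2 * R * (1 / 2) ^ n) * weight \<beta> t x v"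
      using time_integral_Qcoll_diff_bound[OF adm Suc.IH \<beta>, of t ?y v]
      by (simp add: collision_constant_def weight_unsharp)
    also have "\<dots> \<le> 1 / 2 * (2 * R * (1 / 2) ^ n) * weight \<beta> t x v"
      using small R weight_pos[of \<beta> t x v] by (intro mult_right_mono) auto
    finally show ?case by simp
  qed
  have "(\<lambda>n. 2 * R * (1 / 2) ^ n * weight \<beta> t x v) \<longlonglongrightarrow> 2 * R * 0 * weight \<beta> t x v"
    by (intro tendsto_mult tendsto_const LIMSEQ_realpow_zero) simp_all
  then have "\<bar>F t x v - G t x v\<bar> \<le> 2 * R * 0 * weight \<beta> t x v"
    by (rule LIMSEQ_le_const) (intro exI allI impI diff[OF t])
  then show ?thesis by simp
qed

text \<open>Enlarging the coefficient 4 to 12 expresses the constant through the combination R + R^2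
  of the smallness hypothesis.\<close>

lemma collision_constant_le:
  assumes "0 \<le> r" "r \<le> R" "\<beta> > 0"
  shows "collision_constant \<beta> r \<le> 12 * sphere_area * pi\<^sup>2 * ((R + R\<^sup>2) / \<beta>\<^sup>2)"
proof -
  have "4 * r \<le> 12 * R" using assms by linarith
  moreover have "12 * r\<^sup>2 \<le> 12 * R\<^sup>2" by (intro mult_left_mono power_mono assms) simp
  ultimately have "4 * r + 12 * r\<^sup>2 \<le> 12 * (R + R\<^sup>2)" unfolding distrib_left by (rule add_mono)
  then have "sphere_area * pi\<^sup>2 * (4 * r + 12 * r\<^sup>2) / \<beta>\<^sup>2 \<le> sphere_area * pi\<^sup>2 * (12 * (R + R\<^sup>2)) / \<beta>\<^sup>2"
    by (intro divide_right_mono mult_left_mono) auto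
  also have "\<dots> = 12 * sphere_area * pi\<^sup>2 * ((R + R\<^sup>2) / \<beta>\<^sup>2)"
    by (simp only: times_divide_eq_right mult_ac)
  finally show ?thesis unfolding collision_constant_def .
qed

theorem theorem4p12:
  "\<exists>\<epsilon>::real. \<epsilon> > 0 \<and> (\<forall>\<beta>::real. \<beta> > 0 \<longrightarrow>
     (\<exists>R\<^sub>0>0. (R\<^sub>0 + R\<^sub>0\<^sup>2) / \<beta>\<^sup>2 \<le> \<epsilon>) \<and>
     (\<forall>R\<^sub>0>0. (R\<^sub>0 + R\<^sub>0\<^sup>2) / \<beta>\<^sup>2 \<le> \<epsilon> \<longrightarrow>
       (\<exists>\<delta>>0. \<forall>F\<^sub>0 \<in> datum_space \<beta>.
          (\<forall>x v. F\<^sub>0 x v \<ge> 0) \<and> datum_norm \<beta> F\<^sub>0 \<le> \<delta> \<longrightarrow>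
          (\<exists>F. fermion_solution \<beta> R\<^sub>0 F\<^sub>0 F \<and>
             (\<forall>G. fermion_solution \<beta> R\<^sub>0 F\<^sub>0 G \<longrightarrow>
                (\<forall>t\<ge>0. \<forall>x v. G t x v = F t x v))))))"
proof -
  define K where "K = 12 * sphere_area * pi\<^sup>2"
  \<comment> \<open>Chosen so that K times \<epsilon> is at most 1/2, independently of \<beta>; the
    summand 1 keeps the denominator positive even if K were 0.\<close>
  define \<epsilon> where "\<epsilon> = 1 / (2 * (K + 1))"
  have K: "0 \<le> K" by (simp add: K_def)
  then have \<epsilon>: "\<epsilon> > 0" "K * \<epsilon> \<le> 1 / 2" by (auto simp: \<epsilon>_def field_simps)
  have small: "collision_constant \<beta> r \<le> 1 / 2"
    if "\<beta> > 0" "0 \<le> r" "r \<le> R" "(R + R\<^sup>2) / \<beta>\<^sup>2 \<le> \<epsilon>" for \<beta> r R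
    using collision_constant_le[OF that(2,3,1)] mult_left_mono[OF that(4) K] \<epsilon>(2) by (simp add: K_def)
  show ?thesis
  proof (rule exI[of _ \<epsilon>], intro conjI allI impI \<epsilon>(1))
    fix \<beta> :: real assume \<beta>: "\<beta> > 0"
    \<comment> \<open>The bound by 1 gives \<open>R\<^sup>2 \<le> R\<close>, so R + R^2 is at most 2
      R, which the second entry of the minimum controls.\<close>
    define R where "R = min 1 (\<epsilon> * \<beta>\<^sup>2 / 2)"
    have R: "0 < R" "R \<le> 1" "2 * R \<le> \<epsilon> * \<beta>\<^sup>2" using \<epsilon>(1) \<beta> by (auto simp: R_def)
    then have "R\<^sup>2 \<le> R" by (simp add: power2_eq_square mult_left_le)
    then have "R + R\<^sup>2 \<le> \<epsilon> * \<beta>\<^sup>2" using R(3) by linarith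
    then have "(R + R\<^sup>2) / \<beta>\<^sup>2 \<le> \<epsilon>" using \<beta> by (simp add: pos_divide_le_eq)
    with R(1) show "\<exists>R\<^sub>0>0. (R\<^sub>0 + R\<^sub>0\<^sup>2) / \<beta>\<^sup>2 \<le> \<epsilon>" by blast
  next
    fix \<beta> R :: real assume \<beta>: "\<beta> > 0" and R: "R > 0" "(R + R\<^sup>2) / \<beta>\<^sup>2 \<le> \<epsilon>"
    \<comment> \<open>Existence is obtained in the ball of radius \<open>r\<close>, where the
      exclusion factors are nonnegative; uniqueness is applied with the full radius
      \<open>R\<close>.\<close>
    define r where "r = min R 1"
    have r: "0 < r" "r \<le> 1" "r \<le> R" using R by (auto simp: r_def)
    show "\<exists>\<delta>>0. \<forall>F\<^sub>0 \<in> datum_space \<beta>. (\<forall>x v. F\<^sub>0 x v \<ge> 0) \<and> datum_norm \<beta> F\<^sub>0 \<le> \<delta> \<longrightarrow>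
          (\<exists>F. fermion_solution \<beta> R F\<^sub>0 F \<and>
             (\<forall>G. fermion_solution \<beta> R F\<^sub>0 G \<longrightarrow> (\<forall>t\<ge>0. \<forall>x v. G t x v = F t x v)))"
    \<comment> \<open>The bound on the datum is half the radius \<open>r\<close>; the other half is
      left to the collision term.\<close>
    proof (intro exI[of _ "r / 2"] conjI ballI impI)
      fix F\<^sub>0 assume "F\<^sub>0 \<in> datum_space \<beta>" "(\<forall>x v. 0 \<le> F\<^sub>0 x v) \<and> datum_norm \<beta> F\<^sub>0 \<le> r / 2"
      then have F0: "F\<^sub>0 \<in> datum_space \<beta>" "\<And>x v. 0 \<le> F\<^sub>0 x v" "datum_norm \<beta> F\<^sub>0 \<le> r / 2" by simp_all
      obtain F where F: "fermion_solution \<beta> r F\<^sub>0 F"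
        by (rule ex_fermion_solution[OF \<beta> r(1,2) small[OF \<beta> less_imp_le[OF r(1)] r(3) R(2)] F0])
      note F_R = fermion_solution_mono[OF F r(3)]
      show "\<exists>F. fermion_solution \<beta> R F\<^sub>0 F \<and>
             (\<forall>G. fermion_solution \<beta> R F\<^sub>0 G \<longrightarrow> (\<forall>t\<ge>0. \<forall>x v. G t x v = F t x v))"
        by (intro exI[of _ F] conjI allI impI F_R
            fermion_solution_unique[OF \<beta> small[OF \<beta> less_imp_le[OF R(1)] order_refl R(2)] F_R])
    qed (use r in simp)
  qed
qed

end
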